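(* Let $Y$ be a real reflexive Banach space, let $\mathfrak{D}^1\subset Y$ be an affine subspace modeled on a dense linear subspace $\mathfrak{D}^1_0\subset Y$, and let $\mathfrak{D}^2\subset Y^*$ be an affine subspace modeled on a dense linear subspace $\mathfrak{D}^2_0\subset Y^*$. Let $T>0$, let $\mathcal{H}:[0,T]\times\mathfrak{D}^1\times\mathfrak{D}^2\to\mathbb{R}$ be a smooth Hamiltonian with partial Fréchet derivatives $D_\varphi\mathcal{H}(t,\varphi,\pi)\in Y^*$ and $D_\pi\mathcal{H}(t,\varphi,\pi)\in Y$, and let $\varphi_0\in\mathfrak{D}^1$ and $\pi_1\in\mathfrak{D}^2$. Let $(\varphi,\pi)\in\mathfrak{C}_{\varphi_0,\pi_1}$. Then the Type II variational principle on Banach spaces $$\delta\mathcal{S}_{\mathrm{II}}[\varphi,\pi]=0\quad\text{for all Type II variations }(\delta\varphi,\delta\pi)\in\mathfrak{C}_{\mathrm{II}}$$ holds if and only if Hamilton's equations with Type II boundary conditions hold: $$\dot\varphi(t)=D_\pi\mathcal{H}(t,\varphi(t),\pi(t)),\qquad\dot\pi(t)=-D_\varphi\mathcal{H}(t,\varphi(t),\pi(t))\qquad\text{for all }t\in(0,T),$$ $$\varphi(0)=\varphi_0,\qquad\pi(T)=\pi_1.$$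
   Context: $\langle\cdot,\cdot\rangle:Y^*\times Y\to\mathbb{R}$ is the duality pairing; $Y^{**}$ is identified with $Y$ by reflexivity. Conventions on domains: $\mathfrak{D}^1_0$ and $\mathfrak{D}^2_0$ carry norms for which the inclusions into $Y$ and $Y^*$ are continuous (the norms inherited from $Y$ and $Y^*$ are allowed, as are e.g. graph norms of densely defined operators), and $\mathfrak{D}^1,\mathfrak{D}^2$ carry the corresponding affine topologies. $\mathcal{H}$ is smooth (in particular $C^1$) with respect to these topologies, and its partial derivatives are represented by elements of $Y^*$ and $Y$: $\frac{d}{d\epsilon}|_{\epsilon=0}\mathcal{H}(t,\varphi+\epsilon\delta\varphi,\pi)=\langle D_\varphi\mathcal{H}(t,\varphi,\pi),\delta\varphi\rangle$ for $\delta\varphi\in\mathfrak{D}^1_0$ and $\frac{d}{d\epsilon}|_{\epsilon=0}\mathcal{H}(t,\varphi,\pi+\epsilon\delta\pi)=\langle\delta\pi,D_\pi\mathcal{H}(t,\varphi,\pi)\rangle$ for $\delta\pi\in\mathfrak{D}^2_0$. Curves: $\mathfrak{C}=\big(C^1([0,T],Y)\cap C^0([0,T],\mathfrak{D}^1)\big)\times\big(C^1([0,T],Y^* )\cap C^0([0,T],\mathfrak{D}^2)\big)$ and $\mathfrak{C}_{\varphi_0,\pi_1}=\{(\varphi,\pi)\in\mathfrak{C}:\varphi(0)=\varphi_0,\ \pi(T)=\pi_1\}$. Type II action on $\mathfrak{C}_{\varphi_0,\pi_1}$: $\mathcal{S}_{\mathrm{II}}[\varphi,\pi]=\langle\pi(T),\varphi(T)\rangle-\int_0^T[\langle\pi(t),\dot\varphi(t)\rangle-\mathcal{H}(t,\varphi(t),\pi(t))]\,dt$.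 Type II variations: $\mathfrak{C}_{\mathrm{II}}$ is the set of $(\delta\varphi,\delta\pi)\in\big(C^1([0,T],Y)\cap C^0([0,T],\mathfrak{D}^1_0)\big)\times\big(C^1([0,T],Y^* )\cap C^0([0,T],\mathfrak{D}^2_0)\big)$ with $\delta\varphi(0)=0$ and $\delta\pi(T)=0$. The variation of the action is $\delta\mathcal{S}_{\mathrm{II}}[\varphi,\pi]=\frac{d}{d\epsilon}\big|_{\epsilon=0}\mathcal{S}_{\mathrm{II}}[\varphi+\epsilon\delta\varphi,\pi+\epsilon\delta\pi]$. *)

theory Defs
  imports "HOL-Analysis.Analysis"
begin

text \<open>The dual of a real normed space \<open>'a\<close> is the Banach space \<open>'a \<Rightarrow>\<^sub>L real\<close>; the duality pairing
  \<open>\<langle>p, x\<rangle>\<close> is \<open>blinfun_apply p x\<close>.\<close>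

definition reflexive_space :: "'a::real_normed_vector itself \<Rightarrow> bool" where
  "reflexive_space _ \<longleftrightarrow>
     (\<forall>F :: ('a \<Rightarrow>\<^sub>L real) \<Rightarrow>\<^sub>L real. \<exists>y :: 'a. \<forall>p. blinfun_apply F p = blinfun_apply p y)"

definition norm_on_subspace :: "'v::real_vector set \<Rightarrow> ('v \<Rightarrow> real) \<Rightarrow> bool" where
  "norm_on_subspace E N \<longleftrightarrow>
     (\<forall>x\<in>E. 0 \<le> N x \<and> (N x = 0 \<longleftrightarrow> x = 0)) \<and>
     (\<forall>x\<in>E. \<forall>c. N (c *\<^sub>R x) = \<bar>c\<bar> * N x) \<and>
     (\<forall>x\<in>E. \<forall>y\<in>E. N (x + y) \<le> N x + N y)"

text \<open>\<open>D\<close> is an affine subspace modeled on the dense linear subspace \<open>D0\<close>, and \<open>N\<close> is a norm on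
  \<open>D0\<close> making the inclusion into the ambient space continuous. Values of \<open>N\<close> outside \<open>D0\<close> are
  irrelevant. The affine topology of \<open>D\<close> is that of the metric \<open>N (x - y)\<close>.\<close>

definition normed_affine_domain ::
  "'v::real_normed_vector set \<Rightarrow> 'v set \<Rightarrow> ('v \<Rightarrow> real) \<Rightarrow> bool" where
  "normed_affine_domain D D0 N \<longleftrightarrow>
     subspace D0 \<and> closure D0 = UNIV \<and> affine_parallel D0 D \<and>
     norm_on_subspace D0 N \<and> (\<exists>C. \<forall>x\<in>D0. norm x \<le> C * N x)"

definition multilinear_form_on ::
  "nat \<Rightarrow> 'v::real_vector set \<Rightarrow> ('v list \<Rightarrow> real) \<Rightarrow> bool" where
  "multilinear_form_on k E m \<longleftrightarrow>
     (\<forall>hs i u v c. length hs = k \<and> set hs \<subseteq> E \<and> i < k \<and> u \<in> E \<and> v \<in> E \<longrightarrow>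
        m (hs[i := u + c *\<^sub>R v]) = m (hs[i := u]) + c * m (hs[i := v]))"

definition bounded_multilinear_form_on ::
  "nat \<Rightarrow> 'v::real_vector set \<Rightarrow> ('v \<Rightarrow> real) \<Rightarrow> ('v list \<Rightarrow> real) \<Rightarrow> bool" where
  "bounded_multilinear_form_on k E N m \<longleftrightarrow>
     multilinear_form_on k E m \<and>
     (\<exists>B. \<forall>hs. length hs = k \<and> set hs \<subseteq> E \<longrightarrow> \<bar>m hs\<bar> \<le> B * prod_list (map N hs))"

text \<open>\<open>f\<close> is infinitely often Frechet differentiable on \<open>U\<close>, relative to \<open>U\<close>, where \<open>U\<close> lies in an
  affine space modeled on the normed space \<open>(E, N)\<close>. \<open>D k x\<close> is the \<open>k\<close>-th derivative at \<open>x\<close>, a bounded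
  \<open>k\<close>-linear form on \<open>E\<close> applied to a list of \<open>k\<close> directions; the last clause says that
  \<open>D (Suc k) x\<close> is the Frechet derivative of \<open>D k\<close> at \<open>x\<close> with respect to the operator norm of
  \<open>k\<close>-linear forms. Continuity of every \<open>D k\<close> follows from its differentiability.\<close>

definition frechet_smooth_on ::
  "'v::real_vector set \<Rightarrow> ('v \<Rightarrow> real) \<Rightarrow> 'v set \<Rightarrow> ('v \<Rightarrow> real) \<Rightarrow> bool" where
  "frechet_smooth_on E N U f \<longleftrightarrow>
     (\<exists>D :: nat \<Rightarrow> 'v \<Rightarrow> 'v list \<Rightarrow> real.
        (\<forall>x\<in>U. D 0 x [] = f x) \<and>
        (\<forall>k. \<forall>x\<in>U. bounded_multilinear_form_on k E N (D k x)) \<and>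
        (\<forall>k. \<forall>x\<in>U. \<forall>e>0. \<exists>d>0. \<forall>y\<in>U. N (y - x) < d \<longrightarrow>
           (\<forall>hs. length hs = k \<and> set hs \<subseteq> E \<longrightarrow>
              \<bar>D k y hs - D k x hs - D (Suc k) x ((y - x) # hs)\<bar>
                \<le> e * N (y - x) * prod_list (map N hs))))"

text \<open>Smoothness on \<open>[0,T] \<times> D1 \<times> D2\<close>; at \<open>t = 0\<close> and \<open>t = T\<close> the time derivatives are one-sided.\<close>

definition smooth_hamiltonian ::
  "real \<Rightarrow> 'a::real_normed_vector set \<Rightarrow> 'a set \<Rightarrow> ('a \<Rightarrow> real) \<Rightarrow>
   'b::real_normed_vector set \<Rightarrow> 'b set \<Rightarrow> ('b \<Rightarrow> real) \<Rightarrow> (real \<Rightarrow> 'a \<Rightarrow> 'b \<Rightarrow> real) \<Rightarrow> bool" where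
  "smooth_hamiltonian T D1 D10 N1 D2 D20 N2 H \<longleftrightarrow>
     frechet_smooth_on (UNIV \<times> D10 \<times> D20) (\<lambda>(s, x, p). \<bar>s\<bar> + N1 x + N2 p)
       ({0..T} \<times> D1 \<times> D2) (\<lambda>(t, x, p). H t x p)"

definition partial_derivatives_represented ::
  "real \<Rightarrow> 'a::real_normed_vector set \<Rightarrow> 'a set \<Rightarrow> ('a \<Rightarrow>\<^sub>L real) set \<Rightarrow> ('a \<Rightarrow>\<^sub>L real) set \<Rightarrow>
   (real \<Rightarrow> 'a \<Rightarrow> ('a \<Rightarrow>\<^sub>L real) \<Rightarrow> real) \<Rightarrow>
   (real \<Rightarrow> 'a \<Rightarrow> ('a \<Rightarrow>\<^sub>L real) \<Rightarrow> ('a \<Rightarrow>\<^sub>L real)) \<Rightarrow>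
   (real \<Rightarrow> 'a \<Rightarrow> ('a \<Rightarrow>\<^sub>L real) \<Rightarrow> 'a) \<Rightarrow> bool" where
  "partial_derivatives_represented T D1 D10 D2 D20 H D\<^sub>\<phi>H D\<^sub>\<pi>H \<longleftrightarrow>
     (\<forall>t\<in>{0..T}. \<forall>x\<in>D1. \<forall>p\<in>D2.
        (\<forall>\<delta>x\<in>D10. ((\<lambda>\<epsilon>. H t (x + \<epsilon> *\<^sub>R \<delta>x) p)
            has_real_derivative blinfun_apply (D\<^sub>\<phi>H t x p) \<delta>x) (at 0)) \<and>
        (\<forall>\<delta>p\<in>D20. ((\<lambda>\<epsilon>. H t x (p + \<epsilon> *\<^sub>R \<delta>p))
            has_real_derivative blinfun_apply \<delta>p (D\<^sub>\<pi>H t x p)) (at 0)))"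

text \<open>Curves are total functions on the reals of which only the restriction to \<open>[0,T]\<close> matters;
  derivatives at the endpoints are one-sided.\<close>

definition C1_on_interval :: "real \<Rightarrow> (real \<Rightarrow> 'v::real_normed_vector) \<Rightarrow> bool" where
  "C1_on_interval T x \<longleftrightarrow>
     (\<exists>x'. continuous_on {0..T} x' \<and>
        (\<forall>t\<in>{0..T}. (x has_vector_derivative x' t) (at t within {0..T})))"

text \<open>The space \<open>C\<^sup>1([0,T],'v) \<inter> C\<^sup>0([0,T],D)\<close>, with \<open>D\<close> carrying the metric \<open>N (x - y)\<close>.\<close>

definition C1_C0_curves ::
  "real \<Rightarrow> 'v::real_normed_vector set \<Rightarrow> ('v \<Rightarrow> real) \<Rightarrow> (real \<Rightarrow> 'v) set" where
  "C1_C0_curves T D N =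
     {x. C1_on_interval T x \<and>
         (\<forall>t\<in>{0..T}. x t \<in> D \<and> ((\<lambda>s. N (x s - x t)) \<longlongrightarrow> 0) (at t within {0..T}))}"

definition type_II_curves ::
  "real \<Rightarrow> 'a::real_normed_vector set \<Rightarrow> ('a \<Rightarrow> real) \<Rightarrow>
   ('a \<Rightarrow>\<^sub>L real) set \<Rightarrow> (('a \<Rightarrow>\<^sub>L real) \<Rightarrow> real) \<Rightarrow> 'a \<Rightarrow> ('a \<Rightarrow>\<^sub>L real) \<Rightarrow>
   ((real \<Rightarrow> 'a) \<times> (real \<Rightarrow> ('a \<Rightarrow>\<^sub>L real))) set" where
  "type_II_curves T D1 N1 D2 N2 \<phi>\<^sub>0 \<pi>\<^sub>1 =
     {(\<phi>, \<pi>). \<phi> \<in> C1_C0_curves T D1 N1 \<and> \<pi> \<in> C1_C0_curves T D2 N2 \<and> \<phi> 0 = \<phi>\<^sub>0 \<and> \<pi> T = \<pi>\<^sub>1}"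

definition type_II_variations ::
  "real \<Rightarrow> 'a::real_normed_vector set \<Rightarrow> ('a \<Rightarrow> real) \<Rightarrow>
   ('a \<Rightarrow>\<^sub>L real) set \<Rightarrow> (('a \<Rightarrow>\<^sub>L real) \<Rightarrow> real) \<Rightarrow>
   ((real \<Rightarrow> 'a) \<times> (real \<Rightarrow> ('a \<Rightarrow>\<^sub>L real))) set" where
  "type_II_variations T D10 N1 D20 N2 =
     {(\<delta>\<phi>, \<delta>\<pi>). \<delta>\<phi> \<in> C1_C0_curves T D10 N1 \<and> \<delta>\<pi> \<in> C1_C0_curves T D20 N2 \<and>
        \<delta>\<phi> 0 = 0 \<and> \<delta>\<pi> T = 0}"

definition type_II_action ::
  "real \<Rightarrow> (real \<Rightarrow> 'a \<Rightarrow> ('a \<Rightarrow>\<^sub>L real) \<Rightarrow> real) \<Rightarrow>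
   (real \<Rightarrow> 'a::real_normed_vector) \<Rightarrow> (real \<Rightarrow> ('a \<Rightarrow>\<^sub>L real)) \<Rightarrow> real" where
  "type_II_action T H \<phi> \<pi> =
     blinfun_apply (\<pi> T) (\<phi> T) -
     integral {0..T} (\<lambda>t.
       blinfun_apply (\<pi> t) (vector_derivative \<phi> (at t within {0..T})) - H t (\<phi> t) (\<pi> t))"

text \<open>The variation exists and equals \<open>v\<close>. A relation is used because \<open>deriv\<close> is unspecified
  where the derivative does not exist.\<close>

definition has_type_II_variation ::
  "real \<Rightarrow> (real \<Rightarrow> 'a \<Rightarrow> ('a \<Rightarrow>\<^sub>L real) \<Rightarrow> real) \<Rightarrow>
   (real \<Rightarrow> 'a::real_normed_vector) \<Rightarrow> (real \<Rightarrow> ('a \<Rightarrow>\<^sub>L real)) \<Rightarrow>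
   (real \<Rightarrow> 'a) \<Rightarrow> (real \<Rightarrow> ('a \<Rightarrow>\<^sub>L real)) \<Rightarrow> real \<Rightarrow> bool" where
  "has_type_II_variation T H \<phi> \<pi> \<delta>\<phi> \<delta>\<pi> v \<longleftrightarrow>
     ((\<lambda>\<epsilon>. type_II_action T H (\<lambda>t. \<phi> t + \<epsilon> *\<^sub>R \<delta>\<phi> t) (\<lambda>t. \<pi> t + \<epsilon> *\<^sub>R \<delta>\<pi> t))
        has_real_derivative v) (at 0)"

end

theory Submission
  imports Defs
begin

text \<open>
  Differentiating under the integral and integrating \<open>\<langle>\<pi>, \<delta>\<phi>'\<rangle>\<close> by parts, where \<open>\<delta>\<phi>(0) = 0\<close> and
  \<open>\<delta>\<pi>(T) = 0\<close> make the boundary terms cancel, gives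
  \<open>\<delta>S = \<integral> \<langle>\<pi>' + D\<^sub>\<phi>H, \<delta>\<phi>\<rangle> - \<langle>\<delta>\<pi>, \<phi>' - D\<^sub>\<pi>H\<rangle> dt\<close>.
  Hamilton's equations therefore imply stationarity. Conversely, variations \<open>\<eta>(t) x\<close> with a scalar
  \<open>\<eta>\<close> and a fixed \<open>x\<close> in the dense model space reduce everything to the scalar fundamental lemma.
  Only the pairings of \<open>D\<^sub>\<phi>H\<close> and \<open>D\<^sub>\<pi>H\<close> with fixed vectors need be continuous in \<open>t\<close>. Density
  gives \<open>\<pi>' + D\<^sub>\<phi>H = 0\<close>; for \<open>\<phi>' - D\<^sub>\<pi>H = 0\<close> one also needs that the dual separates points
  (Hahn-Banach, obtained here from minimal sublinear functionals).
\<close>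

section \<open>The dual of a normed space separates points\<close>

definition sublinear :: "('v::real_vector \<Rightarrow> real) \<Rightarrow> bool" where
  "sublinear q \<longleftrightarrow>
     (\<forall>x y. q (x + y) \<le> q x + q y) \<and> (\<forall>c x. 0 \<le> c \<longrightarrow> q (c *\<^sub>R x) = c * q x)"

lemma sublinearI:
  assumes add: "\<And>x y. q (x + y) \<le> q x + q y"
    and scale: "\<And>c x. 0 < c \<Longrightarrow> q (c *\<^sub>R x) = c * q x"
  shows "sublinear q"
proof -
  have "q 0 = 0"
    using scale[of 2 0] by simp
  then have "q (c *\<^sub>R x) = c * q x" if "0 \<le> c" for c x
    using that scale[of c x] by (cases "c = 0") auto
  with add show ?thesis by (simp add: sublinear_def)
qed

lemma sublinear_add_le: "sublinear q \<Longrightarrow> q (x + y) \<le> q x + q y"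
  by (simp add: sublinear_def)

lemma sublinear_scale: "sublinear q \<Longrightarrow> 0 \<le> c \<Longrightarrow> q (c *\<^sub>R x) = c * q x"
  by (simp add: sublinear_def)

lemma sublinear_zero: "sublinear q \<Longrightarrow> q 0 = 0"
  using sublinear_scale[of q 0 0] by simp

text \<open>The pointwise infimum over \<open>t\<close> of the right-hand side is itself sublinear.
  Taking \<open>t = 0\<close> gives \<open>r x \<le> q x\<close>, and \<open>t = 1\<close> at
  \<open>- y\<close> gives \<open>r (- y) \<le> - q y\<close>; so every linear functional below
  \<open>r\<close> agrees with \<open>q\<close> at \<open>y\<close>.\<close>

lemma sublinear_below_along:
  fixes q :: "'v::real_vector \<Rightarrow> real"
  assumes q: "sublinear q"
  obtains r where "sublinear r" and "\<And>x t. 0 \<le> t \<Longrightarrow> r x \<le> q (x + t *\<^sub>R y) - t * q y"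
proof
  define r where "r x = (INF t\<in>{0..}. q (x + t *\<^sub>R y) - t * q y)" for x
  \<comment> \<open>Subadditivity for \<open>t y = (x + t y) + (- x)\<close> gives a bound
    independent of \<open>t\<close>, so the infimum defining \<open>r\<close> is a genuine
    one.\<close>
  have low: "- q (- x) \<le> q (x + t *\<^sub>R y) - t * q y" if "0 \<le> t" for x t
    using sublinear_add_le[OF q, of "x + t *\<^sub>R y" "- x"] sublinear_scale[OF q that] by simp
  have bdd: "bdd_below ((\<lambda>t. q (x + t *\<^sub>R y) - t * q y) ` {0..})" for x
    using low by (intro bdd_belowI2[where m = "- q (- x)"]) auto
  show lower: "r x \<le> q (x + t *\<^sub>R y) - t * q y" if "0 \<le> t" for x t
    unfolding r_def using that by (intro cINF_lower bdd) auto
  have greatest: "k \<le> r x" if "\<And>t. 0 \<le> t \<Longrightarrow> k \<le> q (x + t *\<^sub>R y) - t * q y" for k x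
    unfolding r_def using that by (intro cINF_greatest) auto
  show "sublinear r"
  proof (rule sublinearI)
    fix x z
    \<comment> \<open>The parameter \<open>s + t\<close> is admissible for \<open>x + z\<close>. The
      infimum over \<open>t\<close> is then taken with \<open>s\<close> fixed, and the one over
      \<open>s\<close> last.\<close>
    have "r (x + z) \<le> (q (x + s *\<^sub>R y) - s * q y) + (q (z + t *\<^sub>R y) - t * q y)"
      if "0 \<le> s" "0 \<le> t" for s t
    proof -
      have "q ((x + s *\<^sub>R y) + (z + t *\<^sub>R y)) \<le> q (x + s *\<^sub>R y) + q (z + t *\<^sub>R y)"
        by (rule sublinear_add_le[OF q])
      moreover have "(x + s *\<^sub>R y) + (z + t *\<^sub>R y) = (x + z) + (s + t) *\<^sub>R y"
        by (simp add: algebra_simps)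
      ultimately show ?thesis
        using lower[of "s + t" "x + z"] that by (simp add: algebra_simps)
    qed
    then have "r (x + z) - (q (x + s *\<^sub>R y) - s * q y) \<le> q (z + t *\<^sub>R y) - t * q y"
      if "0 \<le> s" "0 \<le> t" for s t
      using that by (metis add.commute diff_le_eq)
    then have "r (x + z) - (q (x + s *\<^sub>R y) - s * q y) \<le> r z" if "0 \<le> s" for s
      using that by (intro greatest)
    then have "r (x + z) - r z \<le> r x"
      by (intro greatest) (simp add: algebra_simps)
    then show "r (x + z) \<le> r x + r z" by simp
  next
    fix c :: real and x assume "0 < c"
    \<comment> \<open>The substitution \<open>t / c\<close> proves one inequality for every positive
      factor; the reverse one is the same inequality for the factor \<open>1 / c\<close> at the
      point \<open>c x\<close>.\<close>
    have le: "c * r x \<le> r (c *\<^sub>R x)" if "0 < c" for c x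
    proof (rule greatest)
      fix t :: real assume "0 \<le> t"
      have "c *\<^sub>R (x + (t / c) *\<^sub>R y) = c *\<^sub>R x + t *\<^sub>R y"
        using that by (simp add: scaleR_add_right)
      then have "q (c *\<^sub>R x + t *\<^sub>R y) = c * q (x + (t / c) *\<^sub>R y)"
        using sublinear_scale[OF q, of c "x + (t / c) *\<^sub>R y"] that by simp
      moreover have "c * r x \<le> c * (q (x + (t / c) *\<^sub>R y) - t / c * q y)"
        using that \<open>0 \<le> t\<close> by (intro mult_left_mono lower) auto
      ultimately show "c * r x \<le> q (c *\<^sub>R x + t *\<^sub>R y) - t * q y"
        using that by (simp add: right_diff_distrib)
    qed
    have "(1 / c) * r (c *\<^sub>R x) \<le> r ((1 / c) *\<^sub>R (c *\<^sub>R x))"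
      using \<open>0 < c\<close> by (intro le) simp
    then have "r (c *\<^sub>R x) \<le> c * r x"
      using \<open>0 < c\<close> by (simp add: divide_le_eq mult.commute)
    with le[OF \<open>0 < c\<close>] show "r (c *\<^sub>R x) = c * r x"
      by (rule antisym[rotated])
  qed
qed

text \<open>Infima of chains of sublinear functionals are sublinear, so Zorn's lemma gives a minimal
  one below \<open>q0\<close>. Minimality forces additivity, and additivity together with positive
  homogeneity is linearity.\<close>

lemma linear_below_sublinear:
  fixes q0 :: "'v::real_vector \<Rightarrow> real"
  assumes q0: "sublinear q0"
  shows "\<exists>q. linear q \<and> (\<forall>x. q x \<le> q0 x)"
proof -
  define A where "A = {q. sublinear q \<and> (\<forall>x. q x \<le> q0 x)}"
  \<comment> \<open>This bound is uniform over \<open>A\<close> and keeps the infima of chains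
    finite.\<close>
  have neg: "- q0 (- x) \<le> q x" if "q \<in> A" for q x
  proof -
    have q: "sublinear q" "q (- x) \<le> q0 (- x)"
      using that by (auto simp: A_def)
    have "0 \<le> q x + q (- x)"
      using sublinear_add_le[OF q(1), of x "- x"] sublinear_zero[OF q(1)] by simp
    with q(2) show ?thesis by simp
  qed
  \<comment> \<open>The order is reversed: a functional counts as larger when it is pointwise
    smaller, so a maximal element is a minimal functional.\<close>
  have "\<exists>m\<in>A. \<forall>a\<in>A. (\<forall>x. a x \<le> m x) \<longrightarrow> a = m"
  proof (rule predicate_Zorn)
    show "partial_order_on A (relation_of (\<lambda>m a. \<forall>x. a x \<le> m x) A)"
      by (rule partial_order_on_relation_ofI) (auto intro: order_trans intro!: ext antisym)
  next
    fix C
    assume "C \<in> Chains (relation_of (\<lambda>m a. \<forall>x. a x \<le> m x) A)"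
    then have CA: "C \<subseteq> A" and tot: "\<And>a b. a \<in> C \<Longrightarrow> b \<in> C \<Longrightarrow> (\<forall>x. a x \<le> b x) \<or> (\<forall>x. b x \<le> a x)"
      by (auto simp: Chains_def relation_of_def)
    show "\<exists>u\<in>A. \<forall>a\<in>C. \<forall>x. u x \<le> a x"
    \<comment> \<open>The infimum over an empty chain carries no information; there
      \<open>q0\<close> itself is the bound.\<close>
    proof (cases "C = {}")
      case True
      then show ?thesis using q0 by (auto simp: A_def)
    next
      case False
      define u where "u x = (INF a\<in>C. a x)" for x
      have bdd: "bdd_below ((\<lambda>a. a x) ` C)" for x
        using neg CA by (intro bdd_belowI2[where m = "- q0 (- x)"]) auto
      have lower: "u x \<le> a x" if "a \<in> C" for a x
        unfolding u_def using bdd that by (rule cINF_lower)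
      have greatest: "k \<le> u x" if "\<And>a. a \<in> C \<Longrightarrow> k \<le> a x" for k x
        unfolding u_def using False that by (rule cINF_greatest)
      have "sublinear u"
      proof (rule sublinearI)
        fix x y
        \<comment> \<open>Of two chain members the smaller one serves as \<open>c\<close>, being
          below \<open>a\<close> at \<open>x\<close> and below \<open>b\<close> at \<open>y\<close>
          simultaneously.\<close>
        have "u (x + y) \<le> a x + b y" if ab: "a \<in> C" "b \<in> C" for a b
        proof -
          obtain c where c: "c \<in> C" "c x \<le> a x" "c y \<le> b y"
            using tot[OF ab] ab by auto
          have "c (x + y) \<le> c x + c y"
            using c(1) CA by (auto simp: A_def sublinear_def)
          with c lower[OF c(1), of "x + y"] show ?thesis by linarith
        qed
        then have "u (x + y) - a x \<le> b y" if "a \<in> C" "b \<in> C" for a b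
          using that by (metis add.commute diff_le_eq)
        then have "u (x + y) - a x \<le> u y" if "a \<in> C" for a
          using that by (intro greatest)
        then have "u (x + y) - u y \<le> u x"
          by (intro greatest) (simp add: algebra_simps)
        then show "u (x + y) \<le> u x + u y" by simp
      next
        fix c :: real and x assume "0 < c"
        have hom: "a (c *\<^sub>R x) = c * a x" if "a \<in> C" for a
          using that CA \<open>0 < c\<close> by (auto simp: A_def sublinear_def)
        have "c * u x \<le> u (c *\<^sub>R x)"
          using \<open>0 < c\<close> by (intro greatest) (simp add: hom lower)
        have "u (c *\<^sub>R x) / c \<le> u x"
          using \<open>0 < c\<close> lower[of _ "c *\<^sub>R x"]
          by (intro greatest) (simp add: hom divide_le_eq mult.commute)
        then have "u (c *\<^sub>R x) \<le> c * u x"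
          using \<open>0 < c\<close> by (simp add: divide_le_eq mult.commute)
        with \<open>c * u x \<le> u (c *\<^sub>R x)\<close> show "u (c *\<^sub>R x) = c * u x"
          by (rule antisym[rotated])
      qed
      moreover have "u x \<le> q0 x" for x
      proof -
        obtain a where "a \<in> C" using False by blast
        then have "u x \<le> a x" "a x \<le> q0 x" using lower CA by (auto simp: A_def)
        then show ?thesis by linarith
      qed
      ultimately show ?thesis
        using lower by (intro bexI[of _ u]) (auto simp: A_def)
    qed
  qed
  then obtain q where qA: "q \<in> A" and min: "\<And>a. a \<in> A \<Longrightarrow> (\<And>x. a x \<le> q x) \<Longrightarrow> a = q"
    by blast
  have q: "sublinear q" and qq0: "\<And>x. q x \<le> q0 x"
    using qA by (auto simp: A_def)
  \<comment> \<open>A minimal sublinear functional is superadditive: lowering it along \<open>y\<close> cannot change it.\<close>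
  have "q x + q y \<le> q (x + y)" for x y
  proof -
    obtain r where r: "sublinear r" "\<And>x t. 0 \<le> t \<Longrightarrow> r x \<le> q (x + t *\<^sub>R y) - t * q y"
      using sublinear_below_along[OF q] by metis
    have rq: "r x \<le> q x" for x
      using r(2)[of 0 x] by simp
    then have "r = q"
      using r(1) qq0 by (intro min) (auto simp: A_def intro: order_trans)
    then show ?thesis using r(2)[of 1 x] by simp
  qed
  then have add: "q (x + y) = q x + q y" for x y
    using sublinear_add_le[OF q] antisym by blast
  \<comment> \<open>Oddness carries homogeneity from nonnegative to negative scalars.\<close>
  have "q (- x) = - q x" for x
    using add[of x "- x"] sublinear_zero[OF q] by simp
  then have "q (c *\<^sub>R x) = c * q x" for c x
    using sublinear_scale[OF q, of c x] sublinear_scale[OF q, of "- c" x] by (cases "0 \<le> c") auto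
  with add have "linear q" by (intro linearI) auto
  with qq0 show ?thesis by auto
qed

text \<open>The norm lowered along \<open>z\<close> has a linear minorant \<open>q\<close> with
  \<open>q (- z) \<le> - norm z\<close>. Since \<open>q\<close> also lies below the norm it belongs
  to the dual, and for \<open>z \<noteq> 0\<close> it would not vanish at \<open>z\<close>.\<close>

lemma dual_separates_points:
  fixes z :: "'v::real_normed_vector"
  assumes "\<And>p :: 'v \<Rightarrow>\<^sub>L real. blinfun_apply p z = 0"
  shows "z = 0"
proof (rule ccontr)
  assume "z \<noteq> 0"
  have "sublinear (norm :: 'v \<Rightarrow> real)"
    by (rule sublinearI) (auto simp: norm_triangle_ineq)
  then obtain q0 where q0: "sublinear q0"
    and lower: "\<And>x t. 0 \<le> t \<Longrightarrow> q0 x \<le> norm (x + t *\<^sub>R z) - t * norm z"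
    by (rule sublinear_below_along) blast
  obtain q where q: "linear q" "\<And>x. q x \<le> q0 x"
    using linear_below_sublinear[OF q0] by auto
  have le_norm: "q x \<le> norm x" for x
    using q(2)[of x] lower[of 0 x] by simp
  have "norm (q x) \<le> norm x * 1" for x
    using le_norm[of x] le_norm[of "- x"] linear_neg[OF q(1), of x] by (auto simp: abs_le_iff)
  then have "bounded_linear q"
    using q(1) by (intro bounded_linear_intro[where K = 1]) (auto simp: linear_add linear_scale)
  then have "q (- z) = 0"
    using assms[of "Blinfun q"] by (simp add: bounded_linear_Blinfun_apply linear_neg[OF q(1)])
  moreover have "q0 (- z) \<le> - norm z" "0 < norm z"
    using lower[of 1 "- z"] \<open>z \<noteq> 0\<close> by simp_all
  then have "q (- z) < 0"
    using q(2)[of "- z"] by linarith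
  ultimately show False by simp
qed

section \<open>The fundamental lemma of the calculus of variations\<close>

lemma fundamental_lemma_variations:
  fixes c :: "real \<Rightarrow> real"
  assumes "0 < T" and c: "continuous_on {0..T} c"
    and test: "\<And>\<eta> \<eta>'. \<lbrakk>continuous_on {0..T} \<eta>'; \<eta> 0 = 0; \<eta> T = 0;
       \<And>t. t \<in> {0..T} \<Longrightarrow> (\<eta> has_real_derivative \<eta>' t) (at t within {0..T})\<rbrakk>
       \<Longrightarrow> integral {0..T} (\<lambda>t. \<eta> t * c t) = 0"
    and t: "t \<in> {0..T}"
  shows "c t = 0"
proof -
  \<comment> \<open>Test against the antiderivative \<open>\<eta>\<close> of the mean-zero antiderivative \<open>C\<close> of \<open>c\<close>: it vanishes at both
    ends, and integrating \<open>(\<eta> C)'\<close> yields \<open>\<integral> C\<^sup>2 = - \<integral> \<eta> c = 0\<close>.\<close>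
  define C0 where "C0 t = integral {0..t} c" for t
  define m where "m = integral {0..T} C0 / T"
  define C where "C t = C0 t - m" for t
  define \<eta> where "\<eta> t = integral {0..t} C" for t
  have dC0: "(C0 has_real_derivative c t) (at t within {0..T})" if "t \<in> {0..T}" for t
    unfolding C0_def using integral_has_real_derivative[OF c that] .
  then have dC: "(C has_real_derivative c t) (at t within {0..T})" if "t \<in> {0..T}" for t
    unfolding C_def using that by (auto intro!: derivative_eq_intros)
  have cont0: "continuous_on {0..T} C0"
    using dC0 by (intro DERIV_continuous_on)
  have cont: "continuous_on {0..T} C"
    using dC by (intro DERIV_continuous_on)
  have d\<eta>: "(\<eta> has_real_derivative C t) (at t within {0..T})" if "t \<in> {0..T}" for t
    unfolding \<eta>_def using integral_has_real_derivative[OF cont that] .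
  have \<eta>0: "\<eta> 0 = 0" by (simp add: \<eta>_def)
  have \<eta>T: "\<eta> T = 0"
    using \<open>0 < T\<close> cont0 unfolding \<eta>_def C_def m_def
    by (subst Henstock_Kurzweil_Integration.integral_diff)
       (auto intro: integrable_continuous_interval)
  have "((\<lambda>t. \<eta> t * c t + C t * C t) has_integral \<eta> T * C T - \<eta> 0 * C 0) {0..T}"
    using \<open>0 < T\<close> dC d\<eta>
    by (intro fundamental_theorem_of_calculus)
       (auto simp: has_real_derivative_iff_has_vector_derivative[symmetric] intro!: derivative_eq_intros)
  then have "((\<lambda>t. \<eta> t * c t + C t * C t) has_integral 0) {0..T}"
    by (simp add: \<eta>0 \<eta>T)
  moreover have "((\<lambda>t. \<eta> t * c t) has_integral 0) {0..T}"
  proof -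
    have "continuous_on {0..T} (\<lambda>t. \<eta> t * c t)"
      using d\<eta> by (intro continuous_on_mult c) (rule DERIV_continuous_on)
    then show ?thesis
      using test[OF cont \<eta>0 \<eta>T d\<eta>] by (metis integrable_continuous_interval integrable_integral)
  qed
  ultimately have "((\<lambda>t. (\<eta> t * c t + C t * C t) - \<eta> t * c t) has_integral 0 - 0) {0..T}"
    by (rule has_integral_diff)
  then have "integral {0..T} (\<lambda>t. C t * C t) = 0"
    by (simp add: integral_unique)
  moreover have "continuous_on {0..T} (\<lambda>t. C t * C t)"
    using cont by (intro continuous_on_mult)
  ultimately have "\<forall>s\<in>{0..T}. C s * C s = 0"
    using integral_eq_0_iff[of 0 T "\<lambda>t. C t * C t"] \<open>0 < T\<close> by simp
  then have C_zero: "C s = 0" if "s \<in> {0..T}" for s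
    using that by simp
  \<comment> \<open>\<open>C\<close> vanishes on the whole closed interval, so \<open>0\<close> is a
    derivative of it relative to that interval. Uniqueness of such derivatives, one-sided at the
    ends, covers \<open>t = 0\<close> and \<open>t = T\<close> as well.\<close>
  have "(C has_vector_derivative 0) (at t within {0..T})"
    using C_zero by (intro has_vector_derivative_transform[OF t _ has_vector_derivative_const[of 0]])
  moreover have "(C has_vector_derivative c t) (at t within {0..T})"
    using dC[OF t] by (simp add: has_real_derivative_iff_has_vector_derivative)
  ultimately show ?thesis
    using vector_derivative_unique_within_closed_interval[of 0 T t C 0 "c t"] \<open>0 < T\<close> t by simp
qed

section \<open>Functions of class \<open>C\<^sup>1\<close> on affine domains\<close>

lemma norm_on_subspaceD:
  assumes "norm_on_subspace E N"
  shows norm_on_subspace_nonneg: "x \<in> E \<Longrightarrow> 0 \<le> N x"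
    and norm_on_subspace_eq_0: "x \<in> E \<Longrightarrow> N x = 0 \<longleftrightarrow> x = 0"
    and norm_on_subspace_scale: "x \<in> E \<Longrightarrow> N (c *\<^sub>R x) = \<bar>c\<bar> * N x"
    and norm_on_subspace_triangle: "x \<in> E \<Longrightarrow> y \<in> E \<Longrightarrow> N (x + y) \<le> N x + N y"
  using assms by (auto simp: norm_on_subspace_def)

lemma norm_on_subspace_Times:
  fixes N1 :: "'a::real_vector \<Rightarrow> real" and N2 :: "'b::real_vector \<Rightarrow> real"
  assumes "norm_on_subspace E1 N1" and "norm_on_subspace E2 N2"
  shows "norm_on_subspace (UNIV \<times> E1 \<times> E2) (\<lambda>(s, x, p). \<bar>s::real\<bar> + N1 x + N2 p)"
  unfolding norm_on_subspace_def
proof (intro conjI ballI allI)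
  fix z :: "real \<times> 'a \<times> 'b" assume "z \<in> UNIV \<times> E1 \<times> E2"
  then obtain s x p where z: "z = (s, x, p)" "x \<in> E1" "p \<in> E2" by auto
  note nn = norm_on_subspace_nonneg[OF assms(1) z(2)] norm_on_subspace_nonneg[OF assms(2) z(3)]
  then show "0 \<le> (case z of (s, x, p) \<Rightarrow> \<bar>s\<bar> + N1 x + N2 p)" by (simp add: z)
  have "\<bar>s\<bar> + N1 x + N2 p = 0 \<longleftrightarrow> s = 0 \<and> N1 x = 0 \<and> N2 p = 0"
    using nn by linarith
  then show "(case z of (s, x, p) \<Rightarrow> \<bar>s\<bar> + N1 x + N2 p) = 0 \<longleftrightarrow> z = 0"
    using norm_on_subspace_eq_0[OF assms(1) z(2)] norm_on_subspace_eq_0[OF assms(2) z(3)]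
    by (simp add: z zero_prod_def)
  show "(case c *\<^sub>R z of (s, x, p) \<Rightarrow> \<bar>s\<bar> + N1 x + N2 p)
      = \<bar>c\<bar> * (case z of (s, x, p) \<Rightarrow> \<bar>s\<bar> + N1 x + N2 p)" for c
    using norm_on_subspace_scale[OF assms(1) z(2)] norm_on_subspace_scale[OF assms(2) z(3)]
    by (simp add: z abs_mult distrib_left)
  fix z' :: "real \<times> 'a \<times> 'b" assume "z' \<in> UNIV \<times> E1 \<times> E2"
  then obtain s' x' p' where z': "z' = (s', x', p')" "x' \<in> E1" "p' \<in> E2" by auto
  show "(case z + z' of (s, x, p) \<Rightarrow> \<bar>s\<bar> + N1 x + N2 p)
      \<le> (case z of (s, x, p) \<Rightarrow> \<bar>s\<bar> + N1 x + N2 p) + (case z' of (s, x, p) \<Rightarrow> \<bar>s\<bar> + N1 x + N2 p)"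
    using norm_on_subspace_triangle[OF assms(1) z(2) z'(2)]
      norm_on_subspace_triangle[OF assms(2) z(3) z'(3)] abs_triangle_ineq[of s s']
    by (simp add: z z')
qed

text \<open>The first-order content of smoothness: \<open>L\<close> is the Frechet derivative of
  \<open>f\<close> and is continuous in the operator norm. The norm \<open>N\<close> is not tied to
  any topology of the type, so all convergence is expressed through \<open>N\<close> of
  differences.\<close>

locale frechet_C1 =
  fixes E :: "'v::real_vector set" and N :: "'v \<Rightarrow> real" and U :: "'v set"
    and f :: "'v \<Rightarrow> real" and L :: "'v \<Rightarrow> 'v \<Rightarrow> real"
  assumes subspace: "subspace E"
    and norm: "norm_on_subspace E N"
    and diff_mem: "\<lbrakk>x \<in> U; y \<in> U\<rbrakk> \<Longrightarrow> y - x \<in> E"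
    and L_linear: "\<lbrakk>x \<in> U; u \<in> E; v \<in> E\<rbrakk> \<Longrightarrow> L x (u + c *\<^sub>R v) = L x u + c * L x v"
    and L_bounded: "x \<in> U \<Longrightarrow> \<exists>B\<ge>0. \<forall>h\<in>E. \<bar>L x h\<bar> \<le> B * N h"
    and L_derivative: "\<lbrakk>x \<in> U; 0 < e\<rbrakk> \<Longrightarrow>
      \<exists>d>0. \<forall>y\<in>U. N (y - x) < d \<longrightarrow> \<bar>f y - f x - L x (y - x)\<bar> \<le> e * N (y - x)"
    and L_continuous: "\<lbrakk>x \<in> U; 0 < e\<rbrakk> \<Longrightarrow>
      \<exists>d>0. \<forall>y\<in>U. N (y - x) < d \<longrightarrow> (\<forall>h\<in>E. \<bar>L y h - L x h\<bar> \<le> e * N h)"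
begin

lemmas N_nonneg = norm_on_subspace_nonneg[OF norm]
  and N_scale = norm_on_subspace_scale[OF norm]
  and N_triangle = norm_on_subspace_triangle[OF norm]

lemma L_add: "\<lbrakk>x \<in> U; u \<in> E; v \<in> E\<rbrakk> \<Longrightarrow> L x (u + v) = L x u + L x v"
  using L_linear[of x u v 1] by simp

text \<open>Differentiability with tolerance \<open>1\<close> and boundedness of \<open>L z0\<close>
  give a bound \<open>(1 + B) * N (y - z0)\<close> for the increment near \<open>z0\<close>. The
  filter is arbitrary so that limits in two parameters are covered.\<close>

lemma f_tendsto:
  assumes z: "eventually (\<lambda>s. z s \<in> U) F" "z0 \<in> U" "((\<lambda>s. N (z s - z0)) \<longlongrightarrow> 0) F"
  shows "((\<lambda>s. f (z s)) \<longlongrightarrow> f z0) F"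
proof -
  obtain B where B: "0 \<le> B" "\<And>h. h \<in> E \<Longrightarrow> \<bar>L z0 h\<bar> \<le> B * N h"
    using L_bounded[OF z(2)] by blast
  obtain d where d: "0 < d"
    "\<And>y. y \<in> U \<Longrightarrow> N (y - z0) < d \<Longrightarrow> \<bar>f y - f z0 - L z0 (y - z0)\<bar> \<le> 1 * N (y - z0)"
    using L_derivative[OF z(2), of 1] by auto
  have "((\<lambda>s. f (z s) - f z0) \<longlongrightarrow> 0) F"
  proof (rule Lim_null_comparison)
    show "((\<lambda>s. (1 + B) * N (z s - z0)) \<longlongrightarrow> 0) F"
      using tendsto_mult_right_zero[OF z(3)] by simp
    show "\<forall>\<^sub>F s in F. norm (f (z s) - f z0) \<le> (1 + B) * N (z s - z0)"
      using z(1) order_tendstoD(2)[OF z(3) d(1)]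
    proof eventually_elim
      case (elim s)
      show ?case
        using d(2)[OF elim] B(2)[OF diff_mem[OF z(2) elim(1)]] by (simp add: distrib_right)
    qed
  qed
  then show ?thesis by (simp add: LIM_zero_iff)
qed

text \<open>Joint continuity follows from splitting the increment into
  \<open>(L z - L z0) h\<close>, controlled by the operator norm, and \<open>L z0 (h - h0)\<close>,
  controlled by boundedness.\<close>

lemma L_tendsto:
  assumes z: "eventually (\<lambda>s. z s \<in> U) F" "z0 \<in> U" "((\<lambda>s. N (z s - z0)) \<longlongrightarrow> 0) F"
    and h: "eventually (\<lambda>s. h s \<in> E) F" "h0 \<in> E" "((\<lambda>s. N (h s - h0)) \<longlongrightarrow> 0) F"
  shows "((\<lambda>s. L (z s) (h s)) \<longlongrightarrow> L z0 h0) F"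
proof -
  obtain B where B: "0 \<le> B" "\<And>h. h \<in> E \<Longrightarrow> \<bar>L z0 h\<bar> \<le> B * N h"
    using L_bounded[OF z(2)] by blast
  show ?thesis
  proof (rule tendstoI)
    fix e :: real assume "0 < e"
    have pos: "0 < N h0 + 1" using N_nonneg[OF h(2)] by simp
    \<comment> \<open>Near the limit \<open>N (h s)\<close> stays below \<open>N h0 + 1\<close>, so
      this tolerance keeps the first part of the splitting within \<open>e / 2\<close>.\<close>
    define e1 where "e1 = e / 2 / (N h0 + 1)"
    have "0 < e1" using \<open>0 < e\<close> pos by (simp add: e1_def)
    then obtain d where d: "0 < d"
      "\<And>y k. y \<in> U \<Longrightarrow> N (y - z0) < d \<Longrightarrow> k \<in> E \<Longrightarrow> \<bar>L y k - L z0 k\<bar> \<le> e1 * N k"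
      using L_continuous[OF z(2)] by blast
    \<comment> \<open>The \<open>1\<close> gives the bound \<open>N h0 + 1\<close> on
      \<open>N (h s)\<close>; the other entry bounds the second part by \<open>e / 2\<close>, with
      \<open>B + 1\<close> in place of \<open>B\<close> to allow \<open>B = 0\<close>.\<close>
    have "0 < min 1 (e / (2 * (B + 1)))" using \<open>0 < e\<close> B(1) by simp
    from z(1) order_tendstoD(2)[OF z(3) d(1)] h(1) order_tendstoD(2)[OF h(3) this]
    show "\<forall>\<^sub>F s in F. dist (L (z s) (h s)) (L z0 h0) < e"
    proof eventually_elim
      case (elim s)
      have k: "h s - h0 \<in> E"
        using subspace elim h(2) by (simp add: subspace_diff)
      have "N (h s) \<le> N h0 + N (h s - h0)"
        using N_triangle[OF h(2) k] by simp
      then have "e1 * N (h s) \<le> e1 * (N h0 + 1)"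
        using elim \<open>0 < e1\<close> by (intro mult_left_mono) auto
      moreover have "e1 * (N h0 + 1) = e / 2"
        using pos unfolding e1_def by (metis less_irrefl nonzero_eq_divide_eq)
      ultimately have 1: "\<bar>L (z s) (h s) - L z0 (h s)\<bar> \<le> e / 2"
        using d(2)[OF elim(1,2,3)] by linarith
      have "\<bar>L z0 (h s - h0)\<bar> \<le> B * N (h s - h0)" by (rule B(2)[OF k])
      also have "\<dots> \<le> (B + 1) * N (h s - h0)"
        using N_nonneg[OF k] by (simp add: distrib_right)
      also have "\<dots> < (B + 1) * (e / (2 * (B + 1)))"
        using elim B(1) by (intro mult_strict_left_mono) auto
      also have "\<dots> = e / 2" using B(1) by (simp add: field_simps)
      finally have 2: "\<bar>L z0 (h s - h0)\<bar> < e / 2" .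
      have "L z0 (h s) = L z0 h0 + L z0 (h s - h0)"
        using L_add[OF z(2) h(2) k] by simp
      with 1 2 show ?case unfolding dist_real_def by linarith
    qed
  qed
qed

lemma derivative_along_line:
  assumes U: "\<And>\<epsilon>. z + \<epsilon> *\<^sub>R h \<in> U" and h: "h \<in> E"
  shows "((\<lambda>\<epsilon>. f (z + \<epsilon> *\<^sub>R h)) has_real_derivative L (z + \<epsilon>0 *\<^sub>R h) h) (at \<epsilon>0)"
proof -
  let ?z = "\<lambda>\<epsilon>. z + \<epsilon> *\<^sub>R h"
  have "(\<lambda>\<epsilon>. (f (?z \<epsilon>) - f (?z \<epsilon>0)) / (\<epsilon> - \<epsilon>0)) \<midarrow>\<epsilon>0\<rightarrow> L (?z \<epsilon>0) h"
  proof (rule LIM_I)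
    fix r :: real assume "0 < r"
    \<comment> \<open>Dividing by \<open>N h + 1\<close> rather than \<open>N h\<close> includes the
      direction \<open>h = 0\<close>.\<close>
    have pos: "0 < N h + 1" using N_nonneg[OF h] by simp
    obtain d where d: "0 < d" "\<And>y. y \<in> U \<Longrightarrow> N (y - ?z \<epsilon>0) < d \<Longrightarrow>
        \<bar>f y - f (?z \<epsilon>0) - L (?z \<epsilon>0) (y - ?z \<epsilon>0)\<bar> \<le> r / (N h + 1) * N (y - ?z \<epsilon>0)"
      using L_derivative[OF U, of "r / (N h + 1)" \<epsilon>0] \<open>0 < r\<close> pos by auto
    show "\<exists>s>0. \<forall>\<epsilon>. \<epsilon> \<noteq> \<epsilon>0 \<and> norm (\<epsilon> - \<epsilon>0) < s \<longrightarrow>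
        norm ((f (?z \<epsilon>) - f (?z \<epsilon>0)) / (\<epsilon> - \<epsilon>0) - L (?z \<epsilon>0) h) < r"
    proof (intro exI[of _ "d / (N h + 1)"] conjI allI impI)
      show "0 < d / (N h + 1)" using d(1) pos by simp
      fix \<epsilon> assume \<epsilon>: "\<epsilon> \<noteq> \<epsilon>0 \<and> norm (\<epsilon> - \<epsilon>0) < d / (N h + 1)"
      define s where "s = \<epsilon> - \<epsilon>0"
      have s: "s \<noteq> 0" "\<bar>s\<bar> * (N h + 1) < d"
        using \<epsilon> pos by (auto simp: s_def pos_less_divide_eq)
      have zs: "?z \<epsilon> - ?z \<epsilon>0 = s *\<^sub>R h" by (simp add: s_def scaleR_diff_left)
      have "N (s *\<^sub>R h) = \<bar>s\<bar> * N h" by (rule N_scale[OF h])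
      moreover have "\<bar>s\<bar> * N h < d"
        using s by (simp add: distrib_left)
      moreover have "L (?z \<epsilon>0) (s *\<^sub>R h) = s * L (?z \<epsilon>0) h"
        using L_linear[OF U subspace_0[OF subspace] h, of \<epsilon>0 s]
          L_linear[OF U subspace_0[OF subspace] h, of \<epsilon>0 0]
          L_add[OF U subspace_0[OF subspace] subspace_0[OF subspace], of \<epsilon>0] by simp
      ultimately have "\<bar>f (?z \<epsilon>) - f (?z \<epsilon>0) - s * L (?z \<epsilon>0) h\<bar> \<le> r / (N h + 1) * (\<bar>s\<bar> * N h)"
        using d(2)[OF U, of \<epsilon>] unfolding zs by simp
      also have "\<dots> < r * \<bar>s\<bar>"
        using pos s(1) \<open>0 < r\<close> by (simp add: field_simps)
      finally have "\<bar>(f (?z \<epsilon>) - f (?z \<epsilon>0) - s * L (?z \<epsilon>0) h) / s\<bar> < r"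
        using s(1) by (simp add: abs_divide divide_less_eq)
      then show "norm ((f (?z \<epsilon>) - f (?z \<epsilon>0)) / (\<epsilon> - \<epsilon>0) - L (?z \<epsilon>0) h) < r"
        using s(1) by (simp add: s_def[symmetric] diff_divide_distrib)
    qed
  qed
  then show ?thesis by (simp add: has_field_derivative_iff)
qed

end

text \<open>Level 0 of the derivative tower is differentiability of \<open>f\<close>. Level 1,
  combined with the bound on the second derivative, makes the first derivative continuous in the
  operator norm.\<close>

lemma frechet_smooth_on_imp_C1:
  assumes smooth: "frechet_smooth_on E N U f" and E: "subspace E" and norm: "norm_on_subspace E N"
    and diff: "\<And>x y. \<lbrakk>x \<in> U; y \<in> U\<rbrakk> \<Longrightarrow> y - x \<in> E"
  obtains L where "frechet_C1 E N U f L"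
proof -
  obtain D where D0: "\<And>x. x \<in> U \<Longrightarrow> D 0 x [] = f x"
    and multi: "\<And>k x. x \<in> U \<Longrightarrow> bounded_multilinear_form_on k E N (D k x)"
    and deriv: "\<And>k x e. x \<in> U \<Longrightarrow> 0 < e \<Longrightarrow> \<exists>d>0. \<forall>y\<in>U. N (y - x) < d \<longrightarrow>
       (\<forall>hs. length hs = k \<and> set hs \<subseteq> E \<longrightarrow> \<bar>D k y hs - D k x hs - D (Suc k) x ((y - x) # hs)\<bar>
           \<le> e * N (y - x) * prod_list (map N hs))"
    using smooth unfolding frechet_smooth_on_def by metis
  have nn: "0 \<le> N h" if "h \<in> E" for h
    using norm_on_subspace_nonneg[OF norm that] .
  have bound: "\<exists>B\<ge>0. \<forall>hs. length hs = k \<and> set hs \<subseteq> E \<longrightarrow> \<bar>D k x hs\<bar> \<le> B * prod_list (map N hs)"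
    if x: "x \<in> U" for k x
  proof -
    obtain B where B: "\<And>hs. length hs = k \<Longrightarrow> set hs \<subseteq> E \<Longrightarrow> \<bar>D k x hs\<bar> \<le> B * prod_list (map N hs)"
      using multi[OF x, of k] by (auto simp: bounded_multilinear_form_on_def)
    \<comment> \<open>The constant supplied by the definition may be negative; products of norms are
      nonnegative, so replacing it by \<open>max 0 B\<close> preserves the estimate.\<close>
    have "\<bar>D k x hs\<bar> \<le> max 0 B * prod_list (map N hs)" if "length hs = k" "set hs \<subseteq> E" for hs
    proof -
      have "0 \<le> prod_list (map N hs)"
        using that(2) nn by (induction hs) auto
      then have "B * prod_list (map N hs) \<le> max 0 B * prod_list (map N hs)"
        by (intro mult_right_mono) auto
      with B[OF that] show ?thesis by linarith
    qed
    then show ?thesis by (intro exI[of _ "max 0 B"]) auto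
  qed
  have "frechet_C1 E N U f (\<lambda>x h. D 1 x [h])"
  proof
    show "subspace E" "norm_on_subspace E N" by fact+
    show "\<lbrakk>x \<in> U; y \<in> U\<rbrakk> \<Longrightarrow> y - x \<in> E" for x y by (rule diff)
    show "D 1 x [u + c *\<^sub>R v] = D 1 x [u] + c * D 1 x [v]" if "x \<in> U" "u \<in> E" "v \<in> E" for x u v c
    proof -
      have "multilinear_form_on 1 E (D 1 x)"
        using multi[OF that(1)] by (simp add: bounded_multilinear_form_on_def)
      then have "length [u] = 1 \<and> set [u] \<subseteq> E \<and> 0 < (1::nat) \<and> u \<in> E \<and> v \<in> E \<longrightarrow>
          D 1 x ([u][0 := u + c *\<^sub>R v]) = D 1 x ([u][0 := u]) + c * D 1 x ([u][0 := v])"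
        unfolding multilinear_form_on_def by blast
      then show ?thesis using that by simp
    qed
    show "\<exists>B\<ge>0. \<forall>h\<in>E. \<bar>D 1 x [h]\<bar> \<le> B * N h" if x: "x \<in> U" for x
    proof -
      obtain B where B: "0 \<le> B"
        "\<And>hs. length hs = 1 \<Longrightarrow> set hs \<subseteq> E \<Longrightarrow> \<bar>D 1 x hs\<bar> \<le> B * prod_list (map N hs)"
        using bound[OF x, of 1] by blast
      have "\<bar>D 1 x [h]\<bar> \<le> B * N h" if "h \<in> E" for h
        using B(2)[of "[h]"] that by simp
      with B(1) show ?thesis by blast
    qed
    show "\<exists>d>0. \<forall>y\<in>U. N (y - x) < d \<longrightarrow> \<bar>f y - f x - D 1 x [y - x]\<bar> \<le> e * N (y - x)"
      if "x \<in> U" "0 < e" for x e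
      using deriv[OF that, of 0] that(1) D0 by auto
    show "\<exists>d>0. \<forall>y\<in>U. N (y - x) < d \<longrightarrow> (\<forall>h\<in>E. \<bar>D 1 y [h] - D 1 x [h]\<bar> \<le> e * N h)"
      if x: "x \<in> U" "0 < e" for x e
    proof -
      obtain B where B: "0 \<le> B"
        "\<And>hs. length hs = 2 \<Longrightarrow> set hs \<subseteq> E \<Longrightarrow> \<bar>D 2 x hs\<bar> \<le> B * prod_list (map N hs)"
        using bound[OF x(1), of 2] by blast
      obtain d where d: "0 < d" "\<And>y hs. y \<in> U \<Longrightarrow> N (y - x) < d \<Longrightarrow> length hs = 1 \<Longrightarrow>
         set hs \<subseteq> E \<Longrightarrow> \<bar>D 1 y hs - D 1 x hs - D 2 x ((y - x) # hs)\<bar>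
           \<le> 1 * N (y - x) * prod_list (map N hs)"
        using deriv[OF x(1) zero_less_one, of 1] unfolding Suc_1 by (metis One_nat_def)
      \<comment> \<open>Within radius \<open>d\<close> the increment of the first derivative has
        norm at most \<open>(1 + B) * N (y - x)\<close>, which explains the radius
        \<open>e / (1 + B)\<close>.\<close>
      show ?thesis
      proof (intro exI[of _ "min d (e / (1 + B))"] conjI ballI impI)
        show "0 < min d (e / (1 + B))" using d(1) x(2) B(1) by simp
        fix y h assume y: "y \<in> U" "N (y - x) < min d (e / (1 + B))" and h: "h \<in> E"
        have "\<bar>D 1 y [h] - D 1 x [h] - D 2 x [y - x, h]\<bar> \<le> N (y - x) * N h"
          using d(2)[of y "[h]"] y h by simp
        moreover have "\<bar>D 2 x [y - x, h]\<bar> \<le> B * (N (y - x) * N h)"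
          using B(2)[of "[y - x, h]"] h diff[OF x(1) y(1)] by simp
        ultimately have "\<bar>D 1 y [h] - D 1 x [h]\<bar> \<le> ((1 + B) * N (y - x)) * N h"
          by (simp add: algebra_simps)
        also have "(1 + B) * N (y - x) \<le> e"
          using y(2) B(1) by (simp add: pos_less_divide_eq mult.commute)
        then have "((1 + B) * N (y - x)) * N h \<le> e * N h"
          using nn[OF h] by (rule mult_right_mono)
        finally show "\<bar>D 1 y [h] - D 1 x [h]\<bar> \<le> e * N h" .
      qed
    qed
  qed
  then show ?thesis by (rule that)
qed

section \<open>The first variation\<close>

lemma normed_affine_domainD:
  assumes "normed_affine_domain D D0 N"
  shows normed_affine_domain_subspace: "subspace D0"
    and normed_affine_domain_dense: "closure D0 = UNIV"
    and normed_affine_domain_norm: "norm_on_subspace D0 N"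
    and normed_affine_domain_diff: "\<lbrakk>x \<in> D; y \<in> D\<rbrakk> \<Longrightarrow> y - x \<in> D0"
    and normed_affine_domain_add: "\<lbrakk>x \<in> D; h \<in> D0\<rbrakk> \<Longrightarrow> x + h \<in> D"
proof -
  show sub: "subspace D0" and "closure D0 = UNIV" and "norm_on_subspace D0 N"
    using assms by (auto simp: normed_affine_domain_def)
  obtain a where D: "D = (\<lambda>x. a + x) ` D0"
    using assms by (auto simp: normed_affine_domain_def affine_parallel_def)
  show "y - x \<in> D0" if "x \<in> D" "y \<in> D"
    using that subspace_diff[OF sub] by (auto simp: D)
  show "x + h \<in> D" if "x \<in> D" "h \<in> D0"
    using that subspace_add[OF sub] by (auto simp: D add.assoc)
qed

lemma C1_C0_curvesD:
  assumes "x \<in> C1_C0_curves T D N" and "t \<in> {0..T}"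
  shows C1_C0_curves_mem: "x t \<in> D"
    and C1_C0_curves_tendsto: "((\<lambda>s. N (x s - x t)) \<longlongrightarrow> 0) (at t within {0..T})"
  using assms by (auto simp: C1_C0_curves_def)

lemma C1_C0_curves_derivative:
  assumes "x \<in> C1_C0_curves T D N"
  obtains x' where "continuous_on {0..T} x'"
    and "\<And>t. t \<in> {0..T} \<Longrightarrow> (x has_vector_derivative x' t) (at t within {0..T})"
proof -
  from assms have "C1_on_interval T x" by (simp add: C1_C0_curves_def)
  then obtain x' where "continuous_on {0..T} x'"
    and "\<forall>t\<in>{0..T}. (x has_vector_derivative x' t) (at t within {0..T})"
    unfolding C1_on_interval_def by (elim exE conjE)
  then show ?thesis by (intro that[of x']) simp_all
qed

text \<open>Punctured neighbourhoods of \<open>(\<epsilon>0, t0)\<close> contain points with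
  \<open>t = t0\<close> and another \<open>\<epsilon>\<close>, so the value of \<open>g\<close> at
  \<open>t0\<close> must agree with its limit.\<close>

lemma tendsto_snd_within_Times:
  fixes g :: "real \<Rightarrow> real"
  assumes "(g \<longlongrightarrow> 0) (at t0 within S)" and "g t0 = 0" and "t0 \<in> S"
  shows "((\<lambda>(\<epsilon>, t). g t) \<longlongrightarrow> 0) (at (\<epsilon>0 :: real, t0) within UNIV \<times> S)"
proof -
  have "continuous (at (snd (\<epsilon>0, t0)) within snd ` (UNIV \<times> S :: (real \<times> real) set)) g"
    using assms by (simp add: continuous_within)
  then have "continuous (at (\<epsilon>0, t0) within UNIV \<times> S) (\<lambda>p. g (snd p))"
    by (rule continuous_within_compose2[OF continuous_snd[OF continuous_ident]])
  then show ?thesis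
    using assms by (simp add: continuous_within case_prod_beta')
qed

lemma perturbed_curve_tendsto:
  assumes D: "normed_affine_domain D D0 N"
    and x: "x \<in> C1_C0_curves T D N" and y: "y \<in> C1_C0_curves T D0 N" and t0: "t0 \<in> {0..T}"
  shows "((\<lambda>(\<epsilon>, t). N ((x t + \<epsilon> *\<^sub>R y t) - (x t0 + \<epsilon>0 *\<^sub>R y t0))) \<longlongrightarrow> 0)
           (at (\<epsilon>0, t0) within UNIV \<times> {0..T})"
proof (rule Lim_null_comparison)
  let ?F = "at (\<epsilon>0, t0) within UNIV \<times> {0..T}"
  note norm = normed_affine_domain_norm[OF D] and sub = normed_affine_domain_subspace[OF D]
  have N0: "N 0 = 0" using norm_on_subspace_eq_0[OF norm] subspace_0[OF sub] by simp
  have tx: "((\<lambda>p. N (x (snd p) - x t0)) \<longlongrightarrow> 0) ?F"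
    using tendsto_snd_within_Times[OF C1_C0_curves_tendsto[OF x t0] _ t0] N0
    by (simp add: case_prod_beta')
  have ty: "((\<lambda>p. N (y (snd p) - y t0)) \<longlongrightarrow> 0) ?F"
    using tendsto_snd_within_Times[OF C1_C0_curves_tendsto[OF y t0] _ t0] N0
    by (simp add: case_prod_beta')
  have tf: "(fst \<longlongrightarrow> \<epsilon>0) ?F"
    using tendsto_fst[OF tendsto_ident_at, of "(\<epsilon>0, t0)"] by simp
  have "((\<lambda>p. N (x (snd p) - x t0) + \<bar>fst p\<bar> * N (y (snd p) - y t0) + \<bar>fst p - \<epsilon>0\<bar> * N (y t0))
      \<longlongrightarrow> 0 + \<bar>\<epsilon>0\<bar> * 0 + \<bar>\<epsilon>0 - \<epsilon>0\<bar> * N (y t0)) ?F"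
    by (intro tendsto_intros tx ty tf)
  then show "((\<lambda>p. N (x (snd p) - x t0) + \<bar>fst p\<bar> * N (y (snd p) - y t0) + \<bar>fst p - \<epsilon>0\<bar> * N (y t0))
      \<longlongrightarrow> 0) ?F" by simp
  have "norm (case p of (\<epsilon>, t) \<Rightarrow> N ((x t + \<epsilon> *\<^sub>R y t) - (x t0 + \<epsilon>0 *\<^sub>R y t0)))
      \<le> N (x (snd p) - x t0) + \<bar>fst p\<bar> * N (y (snd p) - y t0) + \<bar>fst p - \<epsilon>0\<bar> * N (y t0)"
    if "p \<in> UNIV \<times> {0..T}" for p
  proof -
    obtain \<epsilon> t where p: "p = (\<epsilon>, t)" "t \<in> {0..T}" using \<open>p \<in> UNIV \<times> {0..T}\<close> by auto
    have dx: "x t - x t0 \<in> D0"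
      using normed_affine_domain_diff[OF D] C1_C0_curves_mem[OF x] t0 p(2) by blast
    have yt: "y t0 \<in> D0" and dy: "y t - y t0 \<in> D0"
      using subspace_diff[OF sub] C1_C0_curves_mem[OF y] t0 p(2) by blast+
    have m: "\<epsilon> *\<^sub>R (y t - y t0) \<in> D0" "(\<epsilon> - \<epsilon>0) *\<^sub>R y t0 \<in> D0"
      "(x t - x t0) + \<epsilon> *\<^sub>R (y t - y t0) \<in> D0"
      using dx dy yt sub by (auto intro: subspace_scale subspace_add)
    \<comment> \<open>Each of the three summands lies in \<open>D0\<close>, where the triangle
      inequality for \<open>N\<close> is available, and each tends to zero.\<close>
    have eq: "(x t + \<epsilon> *\<^sub>R y t) - (x t0 + \<epsilon>0 *\<^sub>R y t0)
        = ((x t - x t0) + \<epsilon> *\<^sub>R (y t - y t0)) + (\<epsilon> - \<epsilon>0) *\<^sub>R y t0"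
      by (simp add: algebra_simps)
    have "0 \<le> N ((x t + \<epsilon> *\<^sub>R y t) - (x t0 + \<epsilon>0 *\<^sub>R y t0))"
      unfolding eq using m dx sub by (intro norm_on_subspace_nonneg[OF norm] subspace_add)
    moreover have "N ((x t + \<epsilon> *\<^sub>R y t) - (x t0 + \<epsilon>0 *\<^sub>R y t0))
        \<le> N (x t - x t0) + \<bar>\<epsilon>\<bar> * N (y t - y t0) + \<bar>\<epsilon> - \<epsilon>0\<bar> * N (y t0)"
      unfolding eq
      using norm_on_subspace_triangle[OF norm m(3,2)] norm_on_subspace_triangle[OF norm dx m(1)]
        norm_on_subspace_scale[OF norm dy, of \<epsilon>] norm_on_subspace_scale[OF norm yt, of "\<epsilon> - \<epsilon>0"]
      by linarith
    ultimately show ?thesis by (simp add: p)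
  qed
  then show "\<forall>\<^sub>F p in ?F. norm (case p of (\<epsilon>, t) \<Rightarrow> N ((x t + \<epsilon> *\<^sub>R y t) - (x t0 + \<epsilon>0 *\<^sub>R y t0)))
      \<le> N (x (snd p) - x t0) + \<bar>fst p\<bar> * N (y (snd p) - y t0) + \<bar>fst p - \<epsilon>0\<bar> * N (y t0)"
    by (auto simp: eventually_at_filter)
qed

text \<open>The derivative of the tower and the represented partial derivatives are both derivatives
  along the same lines, so uniqueness identifies them; additivity of \<open>L\<close> combines the
  two partial directions.\<close>

lemma hamiltonian_gradient:
  assumes D1: "normed_affine_domain D1 D10 N1" and D2: "normed_affine_domain D2 D20 N2"
    and smooth: "smooth_hamiltonian T D1 D10 N1 D2 D20 N2 H"
    and repr: "partial_derivatives_represented T D1 D10 D2 D20 H D\<^sub>\<phi>H D\<^sub>\<pi>H"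
  obtains L where
    "frechet_C1 (UNIV \<times> D10 \<times> D20) (\<lambda>(s, x, p). \<bar>s\<bar> + N1 x + N2 p)
       ({0..T} \<times> D1 \<times> D2) (\<lambda>(t, x, p). H t x p) L"
    and "\<forall>t\<in>{0..T}. \<forall>x\<in>D1. \<forall>p\<in>D2. \<forall>\<delta>x\<in>D10. \<forall>\<delta>p\<in>D20.
       L (t, x, p) (0, \<delta>x, \<delta>p) = blinfun_apply (D\<^sub>\<phi>H t x p) \<delta>x + blinfun_apply \<delta>p (D\<^sub>\<pi>H t x p)"
proof -
  let ?E = "UNIV \<times> D10 \<times> D20" and ?U = "{0..T} \<times> D1 \<times> D2"
  have sub: "subspace ?E"
    by (rule subspace_Times[OF subspace_UNIV subspace_Times[OF
          normed_affine_domain_subspace[OF D1] normed_affine_domain_subspace[OF D2]]])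
  obtain L where L: "frechet_C1 ?E (\<lambda>(s, x, p). \<bar>s\<bar> + N1 x + N2 p) ?U (\<lambda>(t, x, p). H t x p) L"
  proof (rule frechet_smooth_on_imp_C1[OF smooth[unfolded smooth_hamiltonian_def] sub])
    show "norm_on_subspace ?E (\<lambda>(s, x, p). \<bar>s\<bar> + N1 x + N2 p)"
      by (intro norm_on_subspace_Times normed_affine_domain_norm[OF D1] normed_affine_domain_norm[OF D2])
    show "y - x \<in> ?E" if "x \<in> ?U" "y \<in> ?U" for x y
      using that normed_affine_domain_diff[OF D1] normed_affine_domain_diff[OF D2] by auto
  qed
  interpret frechet_C1 ?E "\<lambda>(s, x, p). \<bar>s\<bar> + N1 x + N2 p" ?U "\<lambda>(t, x, p). H t x p" L
    by (rule L)
  have "L (t, x, p) (0, \<delta>x, \<delta>p) = blinfun_apply (D\<^sub>\<phi>H t x p) \<delta>x + blinfun_apply \<delta>p (D\<^sub>\<pi>H t x p)"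
    if m: "t \<in> {0..T}" "x \<in> D1" "p \<in> D2" "\<delta>x \<in> D10" "\<delta>p \<in> D20" for t x p \<delta>x \<delta>p
  proof -
    have 0: "0 \<in> D10" "0 \<in> D20"
      using subspace_0 normed_affine_domain_subspace D1 D2 by blast+
    have sc: "\<epsilon> *\<^sub>R \<delta>x \<in> D10" "\<epsilon> *\<^sub>R \<delta>p \<in> D20" for \<epsilon>
      using m subspace_scale normed_affine_domain_subspace D1 D2 by blast+
    have add: "x + \<epsilon> *\<^sub>R \<delta>x \<in> D1" "p + \<epsilon> *\<^sub>R \<delta>p \<in> D2" for \<epsilon>
      using m sc normed_affine_domain_add D1 D2 by blast+
    \<comment> \<open>The direction has time component \<open>0\<close>, so the whole line stays in
      the domain even at \<open>t = 0\<close> and \<open>t = T\<close>.\<close>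
    have "((\<lambda>\<epsilon>. H t (x + \<epsilon> *\<^sub>R \<delta>x) p) has_real_derivative L (t, x, p) (0, \<delta>x, 0)) (at 0)"
      using derivative_along_line[of "(t, x, p)" "(0, \<delta>x, 0)" 0] m add 0 by simp
    moreover have "((\<lambda>\<epsilon>. H t (x + \<epsilon> *\<^sub>R \<delta>x) p) has_real_derivative blinfun_apply (D\<^sub>\<phi>H t x p) \<delta>x) (at 0)"
      using repr m unfolding partial_derivatives_represented_def by blast
    ultimately have 1: "L (t, x, p) (0, \<delta>x, 0) = blinfun_apply (D\<^sub>\<phi>H t x p) \<delta>x"
      by (rule DERIV_unique)
    have "((\<lambda>\<epsilon>. H t x (p + \<epsilon> *\<^sub>R \<delta>p)) has_real_derivative L (t, x, p) (0, 0, \<delta>p)) (at 0)"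
      using derivative_along_line[of "(t, x, p)" "(0, 0, \<delta>p)" 0] m add 0 by simp
    moreover have "((\<lambda>\<epsilon>. H t x (p + \<epsilon> *\<^sub>R \<delta>p)) has_real_derivative blinfun_apply \<delta>p (D\<^sub>\<pi>H t x p)) (at 0)"
      using repr m unfolding partial_derivatives_represented_def by blast
    ultimately have 2: "L (t, x, p) (0, 0, \<delta>p) = blinfun_apply \<delta>p (D\<^sub>\<pi>H t x p)"
      by (rule DERIV_unique)
    have "L (t, x, p) ((0, \<delta>x, 0) + (0, 0, \<delta>p)) = L (t, x, p) (0, \<delta>x, 0) + L (t, x, p) (0, 0, \<delta>p)"
      using m 0 by (intro L_add) auto
    with 1 2 show ?thesis by simp
  qed
  then show ?thesis by (intro that[OF L]) blast
qed

text \<open>The continuity claim is free of boundary conditions because it is applied to constant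
  \<open>\<delta>\<phi>\<close> and \<open>\<delta>\<pi>\<close>; only the formula uses
  them.\<close>

lemma first_variation:
  fixes \<phi> \<delta>\<phi> :: "real \<Rightarrow> 'a::banach" and \<pi> \<delta>\<pi> :: "real \<Rightarrow> ('a \<Rightarrow>\<^sub>L real)"
  assumes D1: "normed_affine_domain D1 D10 N1" and D2: "normed_affine_domain D2 D20 N2"
    and "0 < T"
    and smooth: "smooth_hamiltonian T D1 D10 N1 D2 D20 N2 H"
    and repr: "partial_derivatives_represented T D1 D10 D2 D20 H D\<^sub>\<phi>H D\<^sub>\<pi>H"
    and \<phi>: "\<phi> \<in> C1_C0_curves T D1 N1" and \<pi>: "\<pi> \<in> C1_C0_curves T D2 N2"
    and \<delta>\<phi>: "\<delta>\<phi> \<in> C1_C0_curves T D10 N1" and \<delta>\<pi>: "\<delta>\<pi> \<in> C1_C0_curves T D20 N2"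
    and cont_\<phi>': "continuous_on {0..T} \<phi>'" and cont_\<pi>': "continuous_on {0..T} \<pi>'"
    and \<phi>': "\<And>t. t \<in> {0..T} \<Longrightarrow> (\<phi> has_vector_derivative \<phi>' t) (at t within {0..T})"
    and \<pi>': "\<And>t. t \<in> {0..T} \<Longrightarrow> (\<pi> has_vector_derivative \<pi>' t) (at t within {0..T})"
  defines "c \<equiv> \<lambda>t. blinfun_apply (\<pi>' t + D\<^sub>\<phi>H t (\<phi> t) (\<pi> t)) (\<delta>\<phi> t)
                   - blinfun_apply (\<delta>\<pi> t) (\<phi>' t - D\<^sub>\<pi>H t (\<phi> t) (\<pi> t))"
  shows first_variation_continuous: "continuous_on {0..T} c"
    and first_variation_formula: "\<delta>\<phi> 0 = 0 \<Longrightarrow> \<delta>\<pi> T = 0 \<Longrightarrow> has_type_II_variation T H \<phi> \<pi> \<delta>\<phi> \<delta>\<pi> (integral {0..T} c)"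
proof -
  let ?E = "UNIV \<times> D10 \<times> D20" and ?U = "{0..T} \<times> D1 \<times> D2"
    and ?N = "\<lambda>(s, x, p). \<bar>s::real\<bar> + N1 x + N2 p" and ?f = "\<lambda>(t, x, p). H t x p"
  obtain L where L: "frechet_C1 ?E ?N ?U ?f L"
    and L_eq: "\<forall>t\<in>{0..T}. \<forall>x\<in>D1. \<forall>p\<in>D2. \<forall>\<delta>x\<in>D10. \<forall>\<delta>p\<in>D20.
       L (t, x, p) (0, \<delta>x, \<delta>p) = blinfun_apply (D\<^sub>\<phi>H t x p) \<delta>x + blinfun_apply \<delta>p (D\<^sub>\<pi>H t x p)"
    by (rule hamiltonian_gradient[OF D1 D2 smooth repr])
  interpret frechet_C1 ?E ?N ?U ?f L by (rule L)
  obtain \<delta>\<phi>' where cont_\<delta>\<phi>': "continuous_on {0..T} \<delta>\<phi>'"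
    and \<delta>\<phi>': "\<And>t. t \<in> {0..T} \<Longrightarrow> (\<delta>\<phi> has_vector_derivative \<delta>\<phi>' t) (at t within {0..T})"
    using C1_C0_curves_derivative[OF \<delta>\<phi>] by blast
  obtain \<delta>\<pi>' where \<delta>\<pi>': "\<And>t. t \<in> {0..T} \<Longrightarrow> (\<delta>\<pi> has_vector_derivative \<delta>\<pi>' t) (at t within {0..T})"
    using C1_C0_curves_derivative[OF \<delta>\<pi>] by blast
  have cont_curves: "continuous_on {0..T} \<phi>" "continuous_on {0..T} \<pi>"
      "continuous_on {0..T} \<delta>\<phi>" "continuous_on {0..T} \<delta>\<pi>"
    using \<phi>' \<pi>' \<delta>\<phi>' \<delta>\<pi>' by (blast intro: continuous_on_vector_derivative)+
  have mem: "\<phi> t \<in> D1" "\<pi> t \<in> D2" "\<delta>\<phi> t \<in> D10" "\<delta>\<pi> t \<in> D20" if "t \<in> {0..T}" for t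
    using that \<phi> \<pi> \<delta>\<phi> \<delta>\<pi> by (auto intro: C1_C0_curves_mem)

  \<comment> \<open>Time is a coordinate of the point \<open>z\<close>, as in the domain of
    smoothness, while the direction \<open>h\<close> has time component \<open>0\<close> because
    time is not varied.\<close>
  define z where "z \<epsilon> t = (t, \<phi> t + \<epsilon> *\<^sub>R \<delta>\<phi> t, \<pi> t + \<epsilon> *\<^sub>R \<delta>\<pi> t)" for \<epsilon> t
  define h where "h t = (0::real, \<delta>\<phi> t, \<delta>\<pi> t)" for t
  have z_mem: "z \<epsilon> t \<in> ?U" if "t \<in> {0..T}" for \<epsilon> t
  proof -
    have "\<epsilon> *\<^sub>R \<delta>\<phi> t \<in> D10" "\<epsilon> *\<^sub>R \<delta>\<pi> t \<in> D20"
      using mem[OF that] subspace_scale[OF normed_affine_domain_subspace[OF D1]]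
        subspace_scale[OF normed_affine_domain_subspace[OF D2]] by simp_all
    then show ?thesis
      using that mem[OF that] normed_affine_domain_add[OF D1] normed_affine_domain_add[OF D2]
      by (simp add: z_def)
  qed
  have h_mem: "h t \<in> ?E" if "t \<in> {0..T}" for t
    using mem[OF that] by (simp add: h_def)
  have N0: "N1 0 = 0" "N2 0 = 0"
    using norm_on_subspace_eq_0[OF normed_affine_domain_norm[OF D1]]
      norm_on_subspace_eq_0[OF normed_affine_domain_norm[OF D2]]
      subspace_0[OF normed_affine_domain_subspace[OF D1]]
      subspace_0[OF normed_affine_domain_subspace[OF D2]] by simp_all
  have z_tendsto: "((\<lambda>q. ?N (z (fst q) (snd q) - z \<epsilon>0 t0)) \<longlongrightarrow> 0) (at (\<epsilon>0, t0) within UNIV \<times> {0..T})"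
    if t0: "t0 \<in> {0..T}" for \<epsilon>0 t0
  proof -
    have "((\<lambda>t. \<bar>t - t0\<bar>) \<longlongrightarrow> \<bar>t0 - t0\<bar>) (at t0 within {0..T})"
      by (intro tendsto_intros)
    then have "((\<lambda>(\<epsilon>::real, t). \<bar>t - t0\<bar>) \<longlongrightarrow> 0) (at (\<epsilon>0, t0) within UNIV \<times> {0..T})"
      using t0 by (intro tendsto_snd_within_Times) auto
    from tendsto_add[OF tendsto_add[OF this perturbed_curve_tendsto[OF D1 \<phi> \<delta>\<phi> t0, of \<epsilon>0]]
        perturbed_curve_tendsto[OF D2 \<pi> \<delta>\<pi> t0, of \<epsilon>0]]
    show ?thesis by (simp add: z_def case_prod_beta')
  qed
  have h_tendsto: "((\<lambda>q. ?N (h (snd q) - h t0)) \<longlongrightarrow> 0) (at (\<epsilon>0, t0) within UNIV \<times> {0..T})"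
    if t0: "t0 \<in> {0..T}" for \<epsilon>0 :: real and t0
  proof -
    have "((\<lambda>(\<epsilon>::real, t). N1 (\<delta>\<phi> t - \<delta>\<phi> t0) + N2 (\<delta>\<pi> t - \<delta>\<pi> t0)) \<longlongrightarrow> 0) (at (\<epsilon>0, t0) within UNIV \<times> {0..T})"
    proof (rule tendsto_snd_within_Times)
      show "((\<lambda>t. N1 (\<delta>\<phi> t - \<delta>\<phi> t0) + N2 (\<delta>\<pi> t - \<delta>\<pi> t0)) \<longlongrightarrow> 0) (at t0 within {0..T})"
        using tendsto_add[OF C1_C0_curves_tendsto[OF \<delta>\<phi> t0] C1_C0_curves_tendsto[OF \<delta>\<pi> t0]] by simp
    qed (use N0 t0 in auto)
    then show ?thesis by (simp add: h_def case_prod_beta')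
  qed
  have ev: "\<forall>\<^sub>F q in at (\<epsilon>0, t0) within UNIV \<times> {0..T}. snd q \<in> {0..T}" for \<epsilon>0 :: real and t0
    unfolding eventually_at_filter by (rule always_eventually) auto
  \<comment> \<open>Continuity is joint in \<open>(\<epsilon>, t)\<close>: for the Hamiltonian it
    makes every slice integrable, for its derivative it permits differentiation under the
    integral.\<close>
  have cont_H: "continuous_on (UNIV \<times> {0..T}) (\<lambda>q. ?f (z (fst q) (snd q)))"
    unfolding continuous_on_def
  proof
    fix q :: "real \<times> real" assume "q \<in> UNIV \<times> {0..T}"
    then obtain \<epsilon>0 t0 where q: "q = (\<epsilon>0, t0)" "t0 \<in> {0..T}" by auto
    show "((\<lambda>q. ?f (z (fst q) (snd q))) \<longlongrightarrow> ?f (z (fst q) (snd q))) (at q within UNIV \<times> {0..T})"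
      unfolding q(1) fst_conv snd_conv
      by (intro f_tendsto z_tendsto z_mem q(2) eventually_mono[OF ev])
  qed
  have cont_L: "continuous_on (UNIV \<times> {0..T}) (\<lambda>q. L (z (fst q) (snd q)) (h (snd q)))"
    unfolding continuous_on_def
  proof
    fix q :: "real \<times> real" assume "q \<in> UNIV \<times> {0..T}"
    then obtain \<epsilon>0 t0 where q: "q = (\<epsilon>0, t0)" "t0 \<in> {0..T}" by auto
    show "((\<lambda>q. L (z (fst q) (snd q)) (h (snd q))) \<longlongrightarrow> L (z (fst q) (snd q)) (h (snd q)))
        (at q within UNIV \<times> {0..T})"
      unfolding q(1) fst_conv snd_conv
      by (intro L_tendsto z_tendsto z_mem h_tendsto h_mem q(2) eventually_mono[OF ev])
  qed
  have deriv_H: "((\<lambda>\<epsilon>. ?f (z \<epsilon> t)) has_real_derivative L (z \<epsilon> t) (h t)) (at \<epsilon>)"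
    if "t \<in> {0..T}" for \<epsilon> t
  proof -
    have z: "z 0 t + \<epsilon> *\<^sub>R h t = z \<epsilon> t" for \<epsilon>
      by (simp add: z_def h_def)
    then have "z 0 t + \<epsilon> *\<^sub>R h t \<in> ?U" for \<epsilon>
      using z_mem[OF that] by simp
    from derivative_along_line[OF this h_mem[OF that], of \<epsilon>] show ?thesis
      unfolding z .
  qed

  \<comment> \<open>\<open>G\<close> is the integrand of the perturbed action and \<open>G'\<close>
    its derivative in \<open>\<epsilon>\<close>, from the product rule for the pairing.\<close>
  define G where "G \<epsilon> t = blinfun_apply (\<pi> t + \<epsilon> *\<^sub>R \<delta>\<pi> t) (\<phi>' t + \<epsilon> *\<^sub>R \<delta>\<phi>' t) - ?f (z \<epsilon> t)" for \<epsilon> t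
  define G' where "G' \<epsilon> t = blinfun_apply (\<delta>\<pi> t) (\<phi>' t + \<epsilon> *\<^sub>R \<delta>\<phi>' t)
      + blinfun_apply (\<pi> t + \<epsilon> *\<^sub>R \<delta>\<pi> t) (\<delta>\<phi>' t) - L (z \<epsilon> t) (h t)" for \<epsilon> t
  have cont_snd: "continuous_on (UNIV \<times> {0..T}) (\<lambda>q. g (snd q))"
    if "continuous_on {0..T} g" for g :: "real \<Rightarrow> 'b::topological_space"
    by (rule continuous_on_compose2[OF that continuous_on_snd[OF continuous_on_id]]) auto
  have cont_G: "continuous_on (UNIV \<times> {0..T}) (\<lambda>q. G (fst q) (snd q))"
    unfolding G_def
    by (intro continuous_intros cont_H cont_curves[THEN cont_snd]
        cont_\<phi>'[THEN cont_snd] cont_\<delta>\<phi>'[THEN cont_snd])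
  have cont_G': "continuous_on (UNIV \<times> {0..T}) (\<lambda>q. G' (fst q) (snd q))"
    unfolding G'_def
    by (intro continuous_intros cont_L cont_curves[THEN cont_snd]
        cont_\<phi>'[THEN cont_snd] cont_\<delta>\<phi>'[THEN cont_snd])
  have slice: "continuous_on {0..T} (g \<epsilon>)"
    if "continuous_on (UNIV \<times> {0..T}) (\<lambda>q. g (fst q) (snd q))" for g :: "real \<Rightarrow> real \<Rightarrow> real" and \<epsilon>
  proof -
    have "continuous_on {0..T} (Pair \<epsilon>)"
      by (intro continuous_on_Pair continuous_on_const continuous_on_id)
    then show ?thesis
      using continuous_on_compose2[OF that, of "{0..T}" "Pair \<epsilon>"] by force
  qed
  have deriv_G: "((\<lambda>\<epsilon>. G \<epsilon> t) has_real_derivative G' \<epsilon> t) (at \<epsilon>)" if "t \<in> {0..T}" for \<epsilon> t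
    unfolding G_def G'_def
    by (auto intro!: derivative_eq_intros deriv_H[OF that]
        simp: blinfun.bilinear_simps algebra_simps)
  \<comment> \<open>\<open>P\<close> is the time derivative of the pairing of \<open>\<pi>\<close>
    with \<open>\<delta>\<phi>\<close>. Subtracting \<open>G' 0\<close> cancels the terms with
    \<open>\<delta>\<phi>'\<close> and leaves \<open>c\<close>.\<close>
  define P where "P t = blinfun_apply (\<pi> t) (\<delta>\<phi>' t) + blinfun_apply (\<pi>' t) (\<delta>\<phi> t)" for t
  have c_eq: "c t = P t - G' 0 t" if "t \<in> {0..T}" for t
    using mem[OF that] that
    by (simp add: c_def P_def G'_def z_def h_def L_eq blinfun.bilinear_simps)
  have cont_P: "continuous_on {0..T} P"
    unfolding P_def by (intro continuous_intros cont_curves cont_\<pi>' cont_\<delta>\<phi>')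
  show "continuous_on {0..T} c"
    \<comment> \<open>The partial derivatives of \<open>H\<close> enter only through
      \<open>L\<close> along the curve, so continuity of \<open>c\<close> follows from that of
      \<open>P\<close> and \<open>G' 0\<close>.\<close>
    by (rule continuous_on_eq[OF continuous_on_diff[OF cont_P slice[OF cont_G', of 0]]])
       (rule c_eq[symmetric])

  assume bc: "\<delta>\<phi> 0 = 0" "\<delta>\<pi> T = 0"
  have leibniz: "((\<lambda>\<epsilon>. integral {0..T} (G \<epsilon>)) has_real_derivative integral {0..T} (G' 0)) (at 0)"
    using leibniz_rule_field_derivative[of UNIV 0 T G G' 0] deriv_G slice[OF cont_G] cont_G'
    by (auto simp: case_prod_beta' intro: integrable_continuous_interval)
  \<comment> \<open>The condition \<open>\<delta>\<pi> T = 0\<close> makes the boundary term affine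
    in \<open>\<epsilon>\<close>.\<close>
  have action: "type_II_action T H (\<lambda>t. \<phi> t + \<epsilon> *\<^sub>R \<delta>\<phi> t) (\<lambda>t. \<pi> t + \<epsilon> *\<^sub>R \<delta>\<pi> t)
      = blinfun_apply (\<pi> T) (\<phi> T) + \<epsilon> * blinfun_apply (\<pi> T) (\<delta>\<phi> T) - integral {0..T} (G \<epsilon>)" for \<epsilon>
  proof -
    have "vector_derivative (\<lambda>t. \<phi> t + \<epsilon> *\<^sub>R \<delta>\<phi> t) (at t within {0..T}) = \<phi>' t + \<epsilon> *\<^sub>R \<delta>\<phi>' t"
      if t: "t \<in> {0..T}" for t
    proof (rule vector_derivative_within_cbox[of 0 T, simplified])
      show "((\<lambda>t. \<phi> t + \<epsilon> *\<^sub>R \<delta>\<phi> t) has_vector_derivative \<phi>' t + \<epsilon> *\<^sub>R \<delta>\<phi>' t) (at t within {0..T})"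
        using \<phi>'[OF t] \<delta>\<phi>'[OF t] by (auto intro!: derivative_eq_intros)
    qed (use t \<open>0 < T\<close> in auto)
    then have "integral {0..T} (\<lambda>t. blinfun_apply (\<pi> t + \<epsilon> *\<^sub>R \<delta>\<pi> t)
          (vector_derivative (\<lambda>t. \<phi> t + \<epsilon> *\<^sub>R \<delta>\<phi> t) (at t within {0..T}))
          - H t (\<phi> t + \<epsilon> *\<^sub>R \<delta>\<phi> t) (\<pi> t + \<epsilon> *\<^sub>R \<delta>\<pi> t)) = integral {0..T} (G \<epsilon>)"
      by (intro integral_cong) (simp add: G_def z_def)
    then show ?thesis
      unfolding type_II_action_def by (simp add: bc blinfun.bilinear_simps)
  qed
  have "((\<lambda>\<epsilon>. blinfun_apply (\<pi> T) (\<phi> T) + \<epsilon> * blinfun_apply (\<pi> T) (\<delta>\<phi> T) - integral {0..T} (G \<epsilon>))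
      has_real_derivative blinfun_apply (\<pi> T) (\<delta>\<phi> T) - integral {0..T} (G' 0)) (at 0)"
    by (auto intro!: derivative_eq_intros leibniz)
  then have variation: "has_type_II_variation T H \<phi> \<pi> \<delta>\<phi> \<delta>\<pi>
      (blinfun_apply (\<pi> T) (\<delta>\<phi> T) - integral {0..T} (G' 0))"
    by (simp add: has_type_II_variation_def action)
  \<comment> \<open>Integration by parts: since \<open>\<delta>\<phi> 0 = 0\<close>, the integral of
    \<open>P\<close> is exactly the boundary contribution to the variation.\<close>
  have "(P has_integral blinfun_apply (\<pi> T) (\<delta>\<phi> T) - blinfun_apply (\<pi> 0) (\<delta>\<phi> 0)) {0..T}"
    unfolding P_def using \<open>0 < T\<close>
    by (intro fundamental_theorem_of_calculus
        bounded_bilinear.has_vector_derivative[OF bounded_bilinear_blinfun_apply] \<pi>' \<delta>\<phi>') auto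
  then have "(P has_integral blinfun_apply (\<pi> T) (\<delta>\<phi> T)) {0..T}"
    by (simp add: bc blinfun.bilinear_simps)
  moreover have "(G' 0 has_integral integral {0..T} (G' 0)) {0..T}"
    by (intro integrable_integral integrable_continuous_interval slice[OF cont_G'])
  ultimately have "((\<lambda>t. P t - G' 0 t) has_integral
      blinfun_apply (\<pi> T) (\<delta>\<phi> T) - integral {0..T} (G' 0)) {0..T}"
    by (rule has_integral_diff)
  then have "(c has_integral blinfun_apply (\<pi> T) (\<delta>\<phi> T) - integral {0..T} (G' 0)) {0..T}"
    by (rule has_integral_eq[rotated]) (rule c_eq[symmetric])
  then have "integral {0..T} c = blinfun_apply (\<pi> T) (\<delta>\<phi> T) - integral {0..T} (G' 0)"
    by (rule integral_unique)
  with variation show "has_type_II_variation T H \<phi> \<pi> \<delta>\<phi> \<delta>\<pi> (integral {0..T} c)"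
    by simp
qed

section \<open>Stationarity and Hamilton's equations\<close>

lemma blinfun_eq_0_dense:
  assumes "closure S = UNIV" and "\<And>x. x \<in> S \<Longrightarrow> blinfun_apply p x = 0"
  shows "p = 0"
proof (rule blinfun_eqI)
  fix x
  have "continuous_on (closure S) (blinfun_apply p)"
    by (intro continuous_intros)
  from continuous_constant_on_closure[OF this assms(2), of x]
  show "blinfun_apply p x = blinfun_apply 0 x"
    by (simp add: assms(1))
qed

text \<open>The curve stays on one line, where \<open>N\<close> of a difference is
  \<open>\<bar>\<eta> s - \<eta> t\<bar> * N x\<close>; continuity of \<open>\<eta>\<close>
  therefore gives continuity for the norm of the domain as well.\<close>

lemma scaled_vector_in_C1_C0_curves:
  assumes D0: "subspace D0" "norm_on_subspace D0 N" and x: "x \<in> D0"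
    and \<eta>': "continuous_on {0..T} \<eta>'"
    and \<eta>: "\<And>t. t \<in> {0..T} \<Longrightarrow> (\<eta> has_real_derivative \<eta>' t) (at t within {0..T})"
  shows "(\<lambda>t. \<eta> t *\<^sub>R x) \<in> C1_C0_curves T D0 N"
proof -
  have "C1_on_interval T (\<lambda>t. \<eta> t *\<^sub>R x)"
    unfolding C1_on_interval_def
  proof (intro exI[of _ "\<lambda>t. \<eta>' t *\<^sub>R x"] conjI ballI)
    show "continuous_on {0..T} (\<lambda>t. \<eta>' t *\<^sub>R x)"
      by (intro continuous_intros \<eta>')
    show "((\<lambda>t. \<eta> t *\<^sub>R x) has_vector_derivative \<eta>' t *\<^sub>R x) (at t within {0..T})"
      if "t \<in> {0..T}" for t
      using has_vector_derivative_scaleR[OF \<eta>[OF that] has_vector_derivative_const[of x]] by simp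
  qed
  moreover have "((\<lambda>s. N (\<eta> s *\<^sub>R x - \<eta> t *\<^sub>R x)) \<longlongrightarrow> 0) (at t within {0..T})"
    if t: "t \<in> {0..T}" for t
  proof -
    have "(\<eta> \<longlongrightarrow> \<eta> t) (at t within {0..T})"
      using has_field_derivative_imp_has_derivative[OF \<eta>[OF t]]
        has_derivative_continuous continuous_within by blast
    then have "((\<lambda>s. \<bar>\<eta> s - \<eta> t\<bar> * N x) \<longlongrightarrow> \<bar>\<eta> t - \<eta> t\<bar> * N x) (at t within {0..T})"
      by (intro tendsto_intros)
    then show ?thesis
      by (simp add: norm_on_subspace_scale[OF D0(2) x] flip: scaleR_diff_left)
  qed
  ultimately show ?thesis
    using subspace_scale[OF D0(1) x] by (simp add: C1_C0_curves_def)
qed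

theorem mainTheorem5:
  fixes D1 D10 :: "'a::banach set" and N1 :: "'a \<Rightarrow> real"
    and D2 D20 :: "('a \<Rightarrow>\<^sub>L real) set" and N2 :: "('a \<Rightarrow>\<^sub>L real) \<Rightarrow> real"
    and T :: real
    and H :: "real \<Rightarrow> 'a \<Rightarrow> ('a \<Rightarrow>\<^sub>L real) \<Rightarrow> real"
    and D\<^sub>\<phi>H :: "real \<Rightarrow> 'a \<Rightarrow> ('a \<Rightarrow>\<^sub>L real) \<Rightarrow> ('a \<Rightarrow>\<^sub>L real)"
    and D\<^sub>\<pi>H :: "real \<Rightarrow> 'a \<Rightarrow> ('a \<Rightarrow>\<^sub>L real) \<Rightarrow> 'a"
    and \<phi>\<^sub>0 :: 'a and \<pi>\<^sub>1 :: "'a \<Rightarrow>\<^sub>L real"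
    and \<phi> :: "real \<Rightarrow> 'a" and \<pi> :: "real \<Rightarrow> ('a \<Rightarrow>\<^sub>L real)"
  assumes "reflexive_space TYPE('a)"
    and "normed_affine_domain D1 D10 N1"
    and "normed_affine_domain D2 D20 N2"
    and "0 < T"
    and "smooth_hamiltonian T D1 D10 N1 D2 D20 N2 H"
    and "partial_derivatives_represented T D1 D10 D2 D20 H D\<^sub>\<phi>H D\<^sub>\<pi>H"
    and "\<phi>\<^sub>0 \<in> D1" and "\<pi>\<^sub>1 \<in> D2"
    and "(\<phi>, \<pi>) \<in> type_II_curves T D1 N1 D2 N2 \<phi>\<^sub>0 \<pi>\<^sub>1"
  shows "(\<forall>(\<delta>\<phi>, \<delta>\<pi>) \<in> type_II_variations T D10 N1 D20 N2.
            has_type_II_variation T H \<phi> \<pi> \<delta>\<phi> \<delta>\<pi> 0)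
      \<longleftrightarrow> (\<forall>t\<in>{0<..<T}.
             (\<phi> has_vector_derivative D\<^sub>\<pi>H t (\<phi> t) (\<pi> t)) (at t) \<and>
             (\<pi> has_vector_derivative - D\<^sub>\<phi>H t (\<phi> t) (\<pi> t)) (at t))
          \<and> \<phi> 0 = \<phi>\<^sub>0 \<and> \<pi> T = \<pi>\<^sub>1"
proof -
  note D1 = assms(2) and D2 = assms(3) and T = assms(4) and smooth = assms(5) and repr = assms(6)
  have \<phi>: "\<phi> \<in> C1_C0_curves T D1 N1" and \<pi>: "\<pi> \<in> C1_C0_curves T D2 N2"
    and bc: "\<phi> 0 = \<phi>\<^sub>0" "\<pi> T = \<pi>\<^sub>1"
    using assms(9) by (auto simp: type_II_curves_def)
  obtain \<phi>' where \<phi>'_cont: "continuous_on {0..T} \<phi>'"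
    and \<phi>': "\<And>t. t \<in> {0..T} \<Longrightarrow> (\<phi> has_vector_derivative \<phi>' t) (at t within {0..T})"
    using C1_C0_curves_derivative[OF \<phi>] by blast
  obtain \<pi>' where \<pi>'_cont: "continuous_on {0..T} \<pi>'"
    and \<pi>': "\<And>t. t \<in> {0..T} \<Longrightarrow> (\<pi> has_vector_derivative \<pi>' t) (at t within {0..T})"
    using C1_C0_curves_derivative[OF \<pi>] by blast
  define A where "A t = \<pi>' t + D\<^sub>\<phi>H t (\<phi> t) (\<pi> t)" for t
  define B where "B t = \<phi>' t - D\<^sub>\<pi>H t (\<phi> t) (\<pi> t)" for t
  note D10 = normed_affine_domain_subspace[OF D1] normed_affine_domain_norm[OF D1]
    and D20 = normed_affine_domain_subspace[OF D2] normed_affine_domain_norm[OF D2]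
  have cont: "continuous_on {0..T} (\<lambda>t. blinfun_apply (A t) (\<delta>\<phi> t) - blinfun_apply (\<delta>\<pi> t) (B t))"
    if "\<delta>\<phi> \<in> C1_C0_curves T D10 N1" "\<delta>\<pi> \<in> C1_C0_curves T D20 N2" for \<delta>\<phi> \<delta>\<pi>
    using first_variation_continuous[OF D1 D2 T smooth repr \<phi> \<pi> that \<phi>'_cont \<pi>'_cont \<phi>' \<pi>']
    by (simp add: A_def B_def)
  have variation: "has_type_II_variation T H \<phi> \<pi> \<delta>\<phi> \<delta>\<pi>
      (integral {0..T} (\<lambda>t. blinfun_apply (A t) (\<delta>\<phi> t) - blinfun_apply (\<delta>\<pi> t) (B t)))"
    if "(\<delta>\<phi>, \<delta>\<pi>) \<in> type_II_variations T D10 N1 D20 N2" for \<delta>\<phi> \<delta>\<pi>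
  proof -
    have m: "\<delta>\<phi> \<in> C1_C0_curves T D10 N1" "\<delta>\<pi> \<in> C1_C0_curves T D20 N2" "\<delta>\<phi> 0 = 0" "\<delta>\<pi> T = 0"
      using that by (auto simp: type_II_variations_def)
    show ?thesis
      using first_variation_formula[OF D1 D2 T smooth repr \<phi> \<pi> m(1,2) \<phi>'_cont \<pi>'_cont \<phi>' \<pi>' m(3,4)]
      by (simp add: A_def B_def)
  qed
  \<comment> \<open>\<open>A\<close> and \<open>B\<close> are the residuals of the two Hamilton
    equations; stationarity is first matched with their vanishing, and the derivatives are restored
    afterwards.\<close>
  have "(\<forall>(\<delta>\<phi>, \<delta>\<pi>) \<in> type_II_variations T D10 N1 D20 N2.
            has_type_II_variation T H \<phi> \<pi> \<delta>\<phi> \<delta>\<pi> 0)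
      \<longleftrightarrow> (\<forall>t\<in>{0<..<T}. A t = 0 \<and> B t = 0)" (is "?stationary \<longleftrightarrow> _")
  proof
    assume stationary: ?stationary
    \<comment> \<open>The variation is a derivative, hence unique: the value \<open>0\<close> and
      the integral formula must coincide.\<close>
    have zero: "integral {0..T} (\<lambda>t. blinfun_apply (A t) (\<delta>\<phi> t) - blinfun_apply (\<delta>\<pi> t) (B t)) = 0"
      if "(\<delta>\<phi>, \<delta>\<pi>) \<in> type_II_variations T D10 N1 D20 N2" for \<delta>\<phi> \<delta>\<pi>
      using variation[OF that] stationary that DERIV_unique
      unfolding has_type_II_variation_def by fast
    have const: "(\<lambda>t. x) \<in> C1_C0_curves T D10 N1" if "x \<in> D10" for x
      using scaled_vector_in_C1_C0_curves[OF D10 that, of T "\<lambda>_. 0" "\<lambda>_. 1"] by simp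
    have const': "(\<lambda>t. p) \<in> C1_C0_curves T D20 N2" if "p \<in> D20" for p
      using scaled_vector_in_C1_C0_curves[OF D20 that, of T "\<lambda>_. 0" "\<lambda>_. 1"] by simp
    note 0 = const[OF subspace_0[OF D10(1)]] const'[OF subspace_0[OF D20(1)]]
    have "A t = 0" if t: "t \<in> {0..T}" for t
    proof (rule blinfun_eq_0_dense[OF normed_affine_domain_dense[OF D1]])
      fix x assume x: "x \<in> D10"
      show "blinfun_apply (A t) x = 0"
      proof (rule fundamental_lemma_variations[where c = "\<lambda>t. blinfun_apply (A t) x", OF T _ _ t])
        show "continuous_on {0..T} (\<lambda>t. blinfun_apply (A t) x)"
          using cont[OF const[OF x] 0(2)] by simp
        fix \<eta> \<eta>' :: "real \<Rightarrow> real"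
        assume \<eta>: "continuous_on {0..T} \<eta>'" "\<eta> 0 = 0" "\<eta> T = 0"
          "\<And>t. t \<in> {0..T} \<Longrightarrow> (\<eta> has_real_derivative \<eta>' t) (at t within {0..T})"
        have "(\<lambda>t. \<eta> t *\<^sub>R x) \<in> C1_C0_curves T D10 N1"
          by (rule scaled_vector_in_C1_C0_curves[OF D10 x \<eta>(1,4)])
        \<comment> \<open>Since \<open>\<eta>\<close> vanishes at both ends, the same test functions
          serve the condition at \<open>0\<close> for \<open>\<delta>\<phi>\<close> and the one at
          \<open>T\<close> for \<open>\<delta>\<pi>\<close>.\<close>
        with 0 \<eta> have "(\<lambda>t. \<eta> t *\<^sub>R x, \<lambda>_. 0) \<in> type_II_variations T D10 N1 D20 N2"
          by (simp add: type_II_variations_def)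
        from zero[OF this] show "integral {0..T} (\<lambda>t. \<eta> t * blinfun_apply (A t) x) = 0"
          by (simp add: blinfun.bilinear_simps)
      qed
    qed
    moreover have "B t = 0" if t: "t \<in> {0..T}" for t
    proof (rule dual_separates_points)
      \<comment> \<open>The pairing with \<open>B t\<close> vanishes first for \<open>p\<close> in
        \<open>D20\<close>; continuity in \<open>p\<close> and density extend this to the whole
        dual, as separation of points requires.\<close>
      have p_B: "blinfun_apply p (B t) = 0" if p: "p \<in> D20" for p
      proof (rule fundamental_lemma_variations[where c = "\<lambda>t. blinfun_apply p (B t)", OF T _ _ t])
        show "continuous_on {0..T} (\<lambda>t. blinfun_apply p (B t))"
          \<comment> \<open>With \<open>\<delta>\<phi> = 0\<close> the integrand is minus the
            pairing, hence the negation.\<close>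
          using continuous_on_minus[OF cont[OF 0(1) const'[OF p]]]
          by (simp add: blinfun.bilinear_simps)
        fix \<eta> \<eta>' :: "real \<Rightarrow> real"
        assume \<eta>: "continuous_on {0..T} \<eta>'" "\<eta> 0 = 0" "\<eta> T = 0"
          "\<And>t. t \<in> {0..T} \<Longrightarrow> (\<eta> has_real_derivative \<eta>' t) (at t within {0..T})"
        have "(\<lambda>t. \<eta> t *\<^sub>R p) \<in> C1_C0_curves T D20 N2"
          by (rule scaled_vector_in_C1_C0_curves[OF D20 p \<eta>(1,4)])
        with 0 \<eta> have "(\<lambda>_. 0, \<lambda>t. \<eta> t *\<^sub>R p) \<in> type_II_variations T D10 N1 D20 N2"
          by (simp add: type_II_variations_def)
        from zero[OF this] show "integral {0..T} (\<lambda>t. \<eta> t * blinfun_apply p (B t)) = 0"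
          by (simp add: blinfun.bilinear_simps)
      qed
      fix p :: "'a \<Rightarrow>\<^sub>L real"
      have "continuous_on (closure D20) (\<lambda>p. blinfun_apply p (B t))"
        by (intro continuous_intros)
      from continuous_constant_on_closure[OF this p_B, of p]
      show "blinfun_apply p (B t) = 0"
        by (simp add: normed_affine_domain_dense[OF D2])
    qed
    ultimately show "\<forall>t\<in>{0<..<T}. A t = 0 \<and> B t = 0" by simp
  next
    assume AB: "\<forall>t\<in>{0<..<T}. A t = 0 \<and> B t = 0"
    \<comment> \<open>The residuals are known to vanish only inside the interval; the two endpoint
      values do not affect the integral.\<close>
    have "integral {0..T} (\<lambda>t. blinfun_apply (A t) (\<delta>\<phi> t) - blinfun_apply (\<delta>\<pi> t) (B t)) = 0" for \<delta>\<phi> \<delta>\<pi>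
    proof (rule integral_unique)
      show "((\<lambda>t. blinfun_apply (A t) (\<delta>\<phi> t) - blinfun_apply (\<delta>\<pi> t) (B t)) has_integral 0) {0..T}"
        using has_integral_spike_interior[of "\<lambda>_. 0" 0 0 T
            "\<lambda>t. blinfun_apply (A t) (\<delta>\<phi> t) - blinfun_apply (\<delta>\<pi> t) (B t)"] AB
        by (simp add: blinfun.bilinear_simps)
    qed
    then show ?stationary
      using variation by auto
  qed
  also have "\<dots> \<longleftrightarrow> (\<forall>t\<in>{0<..<T}.
      (\<phi> has_vector_derivative D\<^sub>\<pi>H t (\<phi> t) (\<pi> t)) (at t) \<and>
      (\<pi> has_vector_derivative - D\<^sub>\<phi>H t (\<phi> t) (\<pi> t)) (at t))"
  \<comment> \<open>At interior points the derivative relative to the interval is the ordinary one,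
    and its uniqueness turns each Hamilton equation into an equality of values.\<close>
  proof (rule ball_cong[OF refl])
    fix t assume t: "t \<in> {0<..<T}"
    then have at: "at t within {0..T} = at t"
      by (simp add: at_within_Icc_at)
    have d: "(\<phi> has_vector_derivative \<phi>' t) (at t)" "(\<pi> has_vector_derivative \<pi>' t) (at t)"
      using \<phi>'[of t] \<pi>'[of t] t by (simp_all add: at)
    have "(\<phi> has_vector_derivative v) (at t) \<longleftrightarrow> \<phi>' t = v" for v
      using d(1) vector_derivative_unique_at by blast
    moreover have "(\<pi> has_vector_derivative v) (at t) \<longleftrightarrow> \<pi>' t = v" for v
      using d(2) vector_derivative_unique_at by blast
    ultimately show "A t = 0 \<and> B t = 0 \<longleftrightarrow>
        (\<phi> has_vector_derivative D\<^sub>\<pi>H t (\<phi> t) (\<pi> t)) (at t) \<and>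
        (\<pi> has_vector_derivative - D\<^sub>\<phi>H t (\<phi> t) (\<pi> t)) (at t)"
      by (auto simp: A_def B_def eq_neg_iff_add_eq_0)
  qed
  finally show ?thesis
    by (simp add: bc)
qed

end
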